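(* Let $\mathcal B=\langle\Sigma,Q,Q_0,\Delta,\Gamma\rangle$ be a nondeterministic Büchi automaton, and let $\mathcal A=\langle\Sigma,2^Q\cup 3^Q,Q_0,\mathsf{ndet}(\delta_S)\cup\Delta_{SB}\cup\mathsf{ndet}(\delta_B),\mathsf{ndet}(\gamma_B)\rangle$ be the limit-deterministic Büchi automaton obtained from $\mathcal B$ (all ingredients are defined in the context). Then the Büchi automaton $$\mathcal S=\big\langle\Sigma,\,3^Q,\,(Q_0,\emptyset),\,\mathsf{ndet}(\delta_B)\cup\mathsf{ndet}(\gamma_{2,1}),\,\mathsf{ndet}(\gamma_B)\cup\mathsf{ndet}(\gamma_{2,1})\big\rangle$$ simulates $\mathcal A$. Moreover $\mathcal S$ is slim (every state has at most two successors for every letter), $\mathcal S$ recognizes the same language as $\mathcal B$, and $\mathcal S$ is good for MDPs.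
   Context: **Automata.** A nondeterministic Büchi automaton is $\langle\Sigma,Q,Q_0,\Delta,\Gamma\rangle$ with finite alphabet $\Sigma$, finite state set $Q$, nonempty set $Q_0\subseteq Q$ of initial states (or a single initial state), transitions $\Delta\subseteq Q\times\Sigma\times Q$, and accepting transitions $\Gamma\subseteq\Delta$. A run on a word starts in an initial state and follows $\Delta$; it is accepting iff it takes transitions of $\Gamma$ infinitely often. The language is the set of words in $\Sigma^\omega$ having an accepting run. Convention: wherever no transition is available for a letter, the automaton is regarded as moving to an added rejecting sink. **Construction.** Let $3^Q=\{(S,S')\mid S'\subsetneq S\subseteq Q\}$ and $3^Q_+=\{(S,S')\mid S'\subseteq S\subseteq Q\}$. For a (partial) function $f:R\times\Sigma\to R$ let $\mathsf{ndet}(f)=\{(q,\sigma,f(q,\sigma))\mid f(q,\sigma)\text{ defined}\}$. For $S\subseteq Q$, $\sigma\in\Sigma$ let $\delta_S(S,\sigma)=\{q'\mid\exists q\in S.\ (q,\sigma,q')\in\Delta\}$ and $\gamma_S(S,\sigma)=\{q'\mid\exists q\in S.\ (q,\sigma,q')\in\Gamma\}$. The raw breakpoint transition $\delta_R:3^Q\times\Sigma\to3^Q_+$ is $\delta_R((S,S'),\sigma)=(\delta_S(S,\sigma),\,\delta_S(S',\sigma)\cup\gamma_S(S,\sigma))$. The partial functions $\delta_B,\gamma_B:3^Q\times\Sigma\to3^Q$ are given, with $(R,R')=\delta_R((S,S'),\sigma)$, by: if $R=\emptyset$, both are undefined at $((S,S'),\sigma)$; else if $R\neq R'$, $\delta_B((S,S'),\sigma)=(R,R')$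 and $\gamma_B$ is undefined there; else ($R=R'\ne\emptyset$) $\delta_B((S,S'),\sigma)=\gamma_B((S,S'),\sigma)=(R',\emptyset)$. $\Delta_{SB}=\{(S,\sigma,(S',\emptyset))\mid S\subseteq Q,\ \emptyset\neq S'\subseteq\delta_S(S,\sigma)\}\subseteq2^Q\times\Sigma\times3^Q$. The partial function $\gamma_{2,1}:3^Q\times\Sigma\to3^Q$ is undefined at $((S,S'),\sigma)$ if $\delta_S(S',\sigma)=\gamma_S(S,\sigma)=\emptyset$, and otherwise $\gamma_{2,1}((S,S'),\sigma)=(\delta_S(S',\sigma)\cup\gamma_S(S,\sigma),\emptyset)$. In $\mathcal A$ the state set is the disjoint union of $2^Q$ and $3^Q$, and the single initial state is the element $Q_0\in2^Q$; in $\mathcal S$ the single initial state is $(Q_0,\emptyset)$. In both tuples the last component is the set of accepting transitions. **Simulation.** "$\mathcal S$ simulates $\mathcal A$" means that the duplicator wins the following game between a spoiler (moving a pebble on $\mathcal A$) and a duplicator (moving a pebble on $\mathcal S$). Both pebbles start on the initial states. In each round the spoiler chooses a letter $\sigma$ and a $\sigma$-transition from her current state; then the duplicator chooses a $\sigma$-transition from his current state. The duplicator wins the play iff his infinite run is accepting or the spoiler's infinite run is rejecting. **MDPs.** A Markov decision process is $\mathcal M=(S,A,T,\Sigma,L)$ with finite sets $S$ of states (with an initial state $s_0$) and $A$ of actions, available actions $\emptyset\ne A(s)\subseteq A$ for each $s$, a distribution $T(s,a)$ on $S$ for each $s\in S$, $a\in A(s)$, and a labeling $L:S\times A\times S\to\Sigma$.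 A run is $s_0,a_1,s_1,a_2,\ldots$ with $T(s_i,a_{i+1})(s_{i+1})>0$; its labeled run is $L(s_0,a_1,s_1),L(s_1,a_2,s_2),\ldots$. A strategy maps each finite run to a distribution on the actions available in its last state. **Good for MDPs.** For an automaton $\mathcal C$ with transition relation $\Delta_{\mathcal C}$ and initial state $q_0$: $\mathsf{PSem}^{\mathcal M}_{\mathcal C}(s_0)$ is the supremum over strategies of $\mathcal M$ of the probability that the labeled run from $s_0$ belongs to the language of $\mathcal C$; $\mathsf{PSyn}^{\mathcal M}_{\mathcal C}(s_0)$ is the supremum over strategies of the product $\mathcal M\times\mathcal C$, started in $(s_0,q_0)$, of the probability that the run of $\mathcal C$ that is built is accepting. A product strategy, based on the past history only, chooses in state $(s,q)$ an action $a\in A(s)$ and, once the successor $s'$ is drawn from $T(s,a)$, an automaton successor $q'$ with $(q,L(s,a,s'),q')\in\Delta_{\mathcal C}$; the product moves to $(s',q')$. $\mathcal C$ is good for MDPs if $\mathsf{PSyn}^{\mathcal M}_{\mathcal C}(s_0)=\mathsf{PSem}^{\mathcal M}_{\mathcal C}(s_0)$ for all MDPs $\mathcal M$ over $\Sigma$ with initial state $s_0$. *)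

theory Defs
  imports "HOL-Probability.Probability"
begin

section \<open>Buechi automata with transition-based acceptance\<close>

record ('a, 'q) nba =
  alphabet :: "'a set"
  states :: "'q set"
  initial :: "'q set"
  transitions :: "('q \<times> 'a \<times> 'q) set"
  acc_transitions :: "('q \<times> 'a \<times> 'q) set"

definition buchi :: "('a, 'q) nba \<Rightarrow> bool" where
  "buchi C \<longleftrightarrow>
     finite (alphabet C) \<and> finite (states C) \<and>
     initial C \<noteq> {} \<and> initial C \<subseteq> states C \<and>
     transitions C \<subseteq> states C \<times> alphabet C \<times> states C \<and>
     acc_transitions C \<subseteq> transitions C"

definition is_run :: "('a, 'q) nba \<Rightarrow> (nat \<Rightarrow> 'a) \<Rightarrow> (nat \<Rightarrow> 'q) \<Rightarrow> bool" where
  "is_run C w r \<longleftrightarrow> r 0 \<in> initial C \<and> (\<forall>n. (r n, w n, r (Suc n)) \<in> transitions C)"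

definition accepting :: "('a, 'q) nba \<Rightarrow> (nat \<Rightarrow> 'a) \<Rightarrow> (nat \<Rightarrow> 'q) \<Rightarrow> bool" where
  "accepting C w r \<longleftrightarrow> (\<exists>\<^sub>\<infinity>n. (r n, w n, r (Suc n)) \<in> acc_transitions C)"

definition language :: "('a, 'q) nba \<Rightarrow> (nat \<Rightarrow> 'a) set" where
  "language C = {w. (\<forall>n. w n \<in> alphabet C) \<and> (\<exists>r. is_run C w r \<and> accepting C w r)}"

definition slim :: "('a, 'q) nba \<Rightarrow> bool" where
  "slim C \<longleftrightarrow> (\<forall>q\<in>states C. \<forall>\<sigma>\<in>alphabet C.
     finite {q'. (q, \<sigma>, q') \<in> transitions C} \<and> card {q'. (q, \<sigma>, q') \<in> transitions C} \<le> 2)"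

text \<open>Only meaningful for automata whose set of initial states is a singleton.\<close>

definition initial_state :: "('a, 'q) nba \<Rightarrow> 'q" where
  "initial_state C = the_elem (initial C)"

text \<open>
  Where no transition is available, an automaton moves to an added rejecting sink, here
  \<^term>\<open>None\<close>. Games and products are played on the completed automata, so that a pebble
  is never stuck. The sink cannot be entered from a state that has a successor for the letter.
\<close>

definition complete :: "('a, 'q) nba \<Rightarrow> ('a, 'q option) nba" where
  "complete C =
    \<lparr> alphabet = alphabet C,
      states = insert None (Some ` states C),
      initial = Some ` initial C,
      transitions = {(Some q, \<sigma>, Some q') | q \<sigma> q'. (q, \<sigma>, q') \<in> transitions C}
            \<union> {(Some q, \<sigma>, None) | q \<sigma>. q \<in> states C \<and> \<sigma> \<in> alphabet C \<and>
                                       (\<nexists>q'. (q, \<sigma>, q') \<in> transitions C)}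
            \<union> {(None, \<sigma>, None) | \<sigma>. \<sigma> \<in> alphabet C},
      acc_transitions = {(Some q, \<sigma>, Some q') | q \<sigma> q'. (q, \<sigma>, q') \<in> acc_transitions C} \<rparr>"


section \<open>The simulation game\<close>

text \<open>
  A strategy of the duplicator receives the rounds played so far (letter, spoiler's successor,
  duplicator's successor), then the letter and the successor just chosen by the spoiler. It is
  winning if in every play that follows it the duplicator's moves are legal and his run is
  accepting unless the spoiler's run is rejecting. As the automata are completed, every finite
  play extends to an infinite one, so it suffices to consider infinite plays.
\<close>

definition duplicator_wins :: "('a, 'q) nba \<Rightarrow> ('a, 'p) nba \<Rightarrow> bool" where
  "duplicator_wins D C \<longleftrightarrow>
    (\<exists>strat :: ('a \<times> 'p \<times> 'q) list \<Rightarrow> 'a \<Rightarrow> 'p \<Rightarrow> 'q. \<forall>w r r'.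
       r 0 = initial_state C \<longrightarrow> (\<forall>n. (r n, w n, r (Suc n)) \<in> transitions C) \<longrightarrow>
       r' 0 = initial_state D \<longrightarrow>
       (\<forall>n. r' (Suc n) =
          strat (map (\<lambda>i. (w i, r (Suc i), r' (Suc i))) [0..<n]) (w n) (r (Suc n))) \<longrightarrow>
       (\<forall>n. (r' n, w n, r' (Suc n)) \<in> transitions D) \<and>
       (accepting D w r' \<or> \<not> accepting C w r))"

definition simulates :: "('a, 'q) nba \<Rightarrow> ('a, 'p) nba \<Rightarrow> bool" where
  "simulates D C \<longleftrightarrow> duplicator_wins (complete D) (complete C)"


section \<open>The constructions\<close>

definition three :: "('a, 'q) nba \<Rightarrow> ('q set \<times> 'q set) set" where
  "three B = {(S, S'). S' \<subset> S \<and> S \<subseteq> states B}"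

definition ndet :: "'r set \<Rightarrow> 'a set \<Rightarrow> ('r \<Rightarrow> 'a \<Rightarrow> 'r option) \<Rightarrow> ('r \<times> 'a \<times> 'r) set" where
  "ndet R \<Sigma> f = {(q, \<sigma>, q'). q \<in> R \<and> \<sigma> \<in> \<Sigma> \<and> f q \<sigma> = Some q'}"

definition delta_S :: "('a, 'q) nba \<Rightarrow> 'q set \<Rightarrow> 'a \<Rightarrow> 'q set" where
  "delta_S B S \<sigma> = {q'. \<exists>q\<in>S. (q, \<sigma>, q') \<in> transitions B}"

definition gamma_S :: "('a, 'q) nba \<Rightarrow> 'q set \<Rightarrow> 'a \<Rightarrow> 'q set" where
  "gamma_S B S \<sigma> = {q'. \<exists>q\<in>S. (q, \<sigma>, q') \<in> acc_transitions B}"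

fun delta_R :: "('a, 'q) nba \<Rightarrow> 'q set \<times> 'q set \<Rightarrow> 'a \<Rightarrow> 'q set \<times> 'q set" where
  "delta_R B (S, S') \<sigma> = (delta_S B S \<sigma>, delta_S B S' \<sigma> \<union> gamma_S B S \<sigma>)"

definition delta_B :: "('a, 'q) nba \<Rightarrow> 'q set \<times> 'q set \<Rightarrow> 'a \<Rightarrow> ('q set \<times> 'q set) option" where
  "delta_B B p \<sigma> = (let (R, R') = delta_R B p \<sigma> in
     if R = {} then None else if R \<noteq> R' then Some (R, R') else Some (R', {}))"

definition gamma_B :: "('a, 'q) nba \<Rightarrow> 'q set \<times> 'q set \<Rightarrow> 'a \<Rightarrow> ('q set \<times> 'q set) option" where
  "gamma_B B p \<sigma> = (let (R, R') = delta_R B p \<sigma> in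
     if R = {} then None else if R \<noteq> R' then None else Some (R', {}))"

definition Delta_SB :: "('a, 'q) nba \<Rightarrow> ('q set \<times> 'a \<times> ('q set \<times> 'q set)) set" where
  "Delta_SB B = {(S, \<sigma>, (S', {})) | S \<sigma> S'.
     S \<subseteq> states B \<and> \<sigma> \<in> alphabet B \<and> S' \<noteq> {} \<and> S' \<subseteq> delta_S B S \<sigma>}"

fun gamma_21 :: "('a, 'q) nba \<Rightarrow> 'q set \<times> 'q set \<Rightarrow> 'a \<Rightarrow> ('q set \<times> 'q set) option" where
  "gamma_21 B (S, S') \<sigma> =
     (if delta_S B S' \<sigma> = {} \<and> gamma_S B S \<sigma> = {} then None
      else Some (delta_S B S' \<sigma> \<union> gamma_S B S \<sigma>, {}))"

definition limit_det :: "('a, 'q) nba \<Rightarrow> ('a, 'q set + 'q set \<times> 'q set) nba" where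
  "limit_det B =
    \<lparr> alphabet = alphabet B,
      states = Pow (states B) <+> three B,
      initial = {Inl (initial B)},
      transitions =
        {(Inl S, \<sigma>, Inl S') | S \<sigma> S'.
           (S, \<sigma>, S') \<in> ndet (Pow (states B)) (alphabet B) (\<lambda>S \<sigma>. Some (delta_S B S \<sigma>))}
        \<union> {(Inl S, \<sigma>, Inr p) | S \<sigma> p. (S, \<sigma>, p) \<in> Delta_SB B}
        \<union> {(Inr p, \<sigma>, Inr p') | p \<sigma> p'. (p, \<sigma>, p') \<in> ndet (three B) (alphabet B) (delta_B B)},
      acc_transitions = {(Inr p, \<sigma>, Inr p') | p \<sigma> p'.
               (p, \<sigma>, p') \<in> ndet (three B) (alphabet B) (gamma_B B)} \<rparr>"

definition slim_aut :: "('a, 'q) nba \<Rightarrow> ('a, 'q set \<times> 'q set) nba" where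
  "slim_aut B =
    \<lparr> alphabet = alphabet B,
      states = three B,
      initial = {(initial B, {})},
      transitions = ndet (three B) (alphabet B) (delta_B B) \<union> ndet (three B) (alphabet B) (gamma_21 B),
      acc_transitions = ndet (three B) (alphabet B) (gamma_B B) \<union> ndet (three B) (alphabet B) (gamma_21 B) \<rparr>"

lemma delta_S_subset: "buchi B \<Longrightarrow> delta_S B S \<sigma> \<subseteq> states B"
  by (auto simp: buchi_def delta_S_def)

lemma gamma_S_subset: "buchi B \<Longrightarrow> gamma_S B S \<sigma> \<subseteq> delta_S B S \<sigma>"
  by (auto simp: buchi_def delta_S_def gamma_S_def)

lemma delta_S_mono: "S' \<subseteq> S \<Longrightarrow> delta_S B S' \<sigma> \<subseteq> delta_S B S \<sigma>"
  by (auto simp: delta_S_def)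

lemma finite_three: "finite (states B) \<Longrightarrow> finite (three B)"
  by (rule finite_subset[of _ "Pow (states B) \<times> Pow (states B)"]) (auto simp: three_def)

lemma delta_B_in_three:
  assumes "buchi B" "p \<in> three B" "delta_B B p \<sigma> = Some p'"
  shows "p' \<in> three B"
proof -
  obtain S S' where p: "p = (S, S')" "S' \<subseteq> S" using assms(2) by (auto simp: three_def)
  show ?thesis
    using assms(3) delta_S_subset[OF assms(1), of S \<sigma>] gamma_S_subset[OF assms(1), of S \<sigma>]
      delta_S_mono[OF p(2), of B \<sigma>]
    by (auto simp: p(1) delta_B_def three_def Let_def split: if_splits)
qed

lemma gamma_B_delta_B: "gamma_B B p \<sigma> = Some p' \<Longrightarrow> delta_B B p \<sigma> = Some p'"
  by (auto simp: delta_B_def gamma_B_def Let_def split: if_splits prod.splits)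

lemma gamma_21_in_three:
  assumes "buchi B" "p \<in> three B" "gamma_21 B p \<sigma> = Some p'"
  shows "p' \<in> three B"
proof -
  obtain S S' where p: "p = (S, S')" by force
  show ?thesis
    using assms(3) delta_S_subset[OF assms(1), of S \<sigma>] gamma_S_subset[OF assms(1), of S \<sigma>]
      delta_S_subset[OF assms(1), of S' \<sigma>]
    by (auto simp: p three_def split: if_splits)
qed

lemma buchi_slim_aut:
  assumes "buchi B"
  shows "buchi (slim_aut B)"
proof -
  have "finite (three B)" "initial B \<noteq> {}" "initial B \<subseteq> states B" "finite (alphabet B)"
    using assms finite_three[of B] by (auto simp: buchi_def)
  moreover from this have "(initial B, {}) \<in> three B" by (auto simp: three_def)
  ultimately show ?thesis
    unfolding buchi_def[of "slim_aut B"]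
    by (intro conjI)
      (auto simp del: gamma_21.simps simp: slim_aut_def ndet_def
        dest: delta_B_in_three[OF assms] gamma_21_in_three[OF assms] gamma_B_delta_B)
qed

lemma buchi_limit_det:
  assumes "buchi B"
  shows "buchi (limit_det B)"
proof -
  have "finite (three B)" "finite (states B)" "initial B \<subseteq> states B" "finite (alphabet B)"
    using assms finite_three[of B] by (auto simp: buchi_def)
  moreover have "p \<in> three B \<and> \<sigma> \<in> alphabet B \<and> (\<forall>q\<in>S. q \<in> states B)"
    if "(S, \<sigma>, p) \<in> Delta_SB B" for S \<sigma> p
    using that delta_S_subset[OF assms] by (fastforce simp: Delta_SB_def three_def)
  ultimately show ?thesis
    unfolding buchi_def[of "limit_det B"]
    by (intro conjI)
      (auto simp: limit_det_def ndet_def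
        dest: delta_B_in_three[OF assms] gamma_B_delta_B subsetD[OF delta_S_subset[OF assms]])
qed


section \<open>Random paths\<close>

text \<open>
  The law of a random sequence whose next element is drawn from \<^term>\<open>K h\<close> when \<^term>\<open>h\<close> is
  the finite sequence seen so far (Ionescu-Tulcea extension). It is determined by its values on
  cylinders, see \<open>path_measure_cylinder\<close>. Countability of the element type makes every
  \<^term>\<open>K\<close> measurable.
\<close>

definition path_measure :: "('x::countable list \<Rightarrow> 'x pmf) \<Rightarrow> (nat \<Rightarrow> 'x) measure" where
  "path_measure K =
    projective_family.lim UNIV
      (Ionescu_Tulcea.CI (\<lambda>n \<omega>. measure_pmf (K (map \<omega> [0..<n]))) (\<lambda>_. count_space UNIV))
      (\<lambda>_. count_space UNIV)"

lemma Ionescu_Tulcea_path: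
  fixes K :: "'x::countable list \<Rightarrow> 'x pmf"
  shows "Ionescu_Tulcea (\<lambda>n \<omega>. measure_pmf (K (map \<omega> [0..<n]))) (\<lambda>_. count_space UNIV)"
proof
  fix n :: nat
  have "(\<lambda>\<omega>. map \<omega> xs) \<in> measurable (PiM {0..<n} (\<lambda>_. count_space UNIV))
      (count_space (UNIV :: 'x list set))"
    if "set xs \<subseteq> {0..<n}" for xs
    using that
  proof (induction xs)
    case (Cons x xs)
    have [measurable]: "(\<lambda>\<omega>. \<omega> x) \<in> measurable (PiM {0..<n} (\<lambda>_. count_space UNIV))
        (count_space (UNIV :: 'x set))"
      using Cons.prems by (intro measurable_component_singleton) auto
    have [measurable]: "(\<lambda>\<omega>. map \<omega> xs) \<in> measurable (PiM {0..<n} (\<lambda>_. count_space UNIV))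
        (count_space (UNIV :: 'x list set))"
      using Cons by auto
    show ?case by simp
  qed auto
  from this[of "[0..<n]"]
  have [measurable]: "(\<lambda>\<omega>. map \<omega> [0..<n]) \<in> measurable (PiM {0..<n} (\<lambda>_. count_space UNIV))
      (count_space (UNIV :: 'x list set))" by simp
  show "(\<lambda>\<omega>. measure_pmf (K (map \<omega> [0..<n]))) \<in> measurable
      (PiM {0..<n} (\<lambda>_. count_space UNIV)) (subprob_algebra (count_space UNIV))"
    by (rule measurable_compose[of _ _ "count_space UNIV"], measurable)
qed

lemma path_measure_cylinder:
  fixes K :: "'x::countable list \<Rightarrow> 'x pmf"
  shows "emeasure (path_measure K) {\<omega>. map \<omega> [0..<length h] = h} =
    (\<Prod>i<length h. ennreal (pmf (K (take i h)) (h ! i)))"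
proof -
  interpret Ionescu_Tulcea "\<lambda>n \<omega>. measure_pmf (K (map \<omega> [0..<n]))" "\<lambda>_. count_space UNIV"
    by (rule Ionescu_Tulcea_path)
  let ?u = "\<lambda>_::nat. undefined :: 'x"
  define r where "r n = restrict ((!) h) {0..<n}" for n
  have X[measurable]: "{r n} \<in> sets (PiM {0..<n} (\<lambda>_. count_space UNIV))" for n
  proof -
    have "{r n} = PiE {0..<n} (\<lambda>i. {r n i})"
      by (rule PiE_singleton[symmetric]) (simp add: r_def)
    also have "\<dots> \<in> sets (PiM {0..<n} (\<lambda>_. count_space UNIV))"
      by (rule sets_PiM_I_finite) auto
    finally show ?thesis .
  qed
  have u: "?u \<in> space (PiM {0..<0} (\<lambda>_. count_space UNIV))" by (simp add: space_PiM)
  have step: "emeasure (eP n \<omega>) {r (Suc n)} =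
      ennreal (pmf (K (take n h)) (h ! n)) * indicator {r n} \<omega>"
    if n: "n < length h" and \<omega>: "\<omega> \<in> space (PiM {0..<n} (\<lambda>_. count_space UNIV))" for n \<omega>
  proof -
    have ext: "\<omega> i = undefined" if "i \<ge> n" for i
      using that \<omega> by (auto simp: space_PiM PiE_def extensional_def)
    have eq: "fun_upd \<omega> n x = r (Suc n) \<longleftrightarrow> \<omega> = r n \<and> x = h ! n" for x
    proof
      assume *: "fun_upd \<omega> n x = r (Suc n)"
      have "\<omega> i = r n i" for i
        using fun_cong[OF *, of i] ext[of i] by (cases "i < n") (auto simp: r_def)
      moreover have "x = h ! n" using fun_cong[OF *, of n] by (simp add: r_def)
      ultimately show "\<omega> = r n \<and> x = h ! n" by auto
    next
      assume *: "\<omega> = r n \<and> x = h ! n"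
      show "fun_upd \<omega> n x = r (Suc n)"
      proof
        fix i show "fun_upd \<omega> n x i = r (Suc n) i" using * by (auto simp: r_def)
      qed
    qed
    have "map (r n) [0..<n] = take n h"
      using n by (intro nth_equalityI) (auto simp: r_def)
    moreover have "{x. fun_upd \<omega> n x = r (Suc n)} = (if \<omega> = r n then {h ! n} else {})"
      using eq by auto
    ultimately show ?thesis
      using emeasure_eP[OF \<omega> X[of "Suc n"]]
      by (auto simp: vimage_def emeasure_pmf_single)
  qed
  have C: "emeasure (C 0 n ?u) {r n} = (\<Prod>i<n. ennreal (pmf (K (take i h)) (h ! i)))"
    if "n \<le> length h" for n
    using that
  proof (induction n)
    case 0
    have "r 0 = ?u" by (auto simp: r_def)
    then show ?case using X[of 0] by simp
  next
    case (Suc n)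
    have sp: "space (C 0 n ?u) = space (PiM {0..<n} (\<lambda>_. count_space UNIV))"
      using space_C[OF u] by simp
    have "emeasure (C 0 (Suc n) ?u) {r (Suc n)} = (\<integral>\<^sup>+\<omega>. emeasure (eP n \<omega>) {r (Suc n)} \<partial>C 0 n ?u)"
    proof -
      have "eP n \<in> measurable (C 0 n ?u) (subprob_algebra (PiM {0..<Suc n} (\<lambda>_. count_space UNIV)))"
        using measurable_eP[of n]
        by (simp only: measurable_cong_sets[OF sets_C[OF u, of n] refl] add_0)
      moreover have "space (C 0 n ?u) \<noteq> {}" using prob_space.not_empty[OF prob_space_C[OF u, of n]] .
      ultimately show ?thesis by (simp add: emeasure_bind[OF _ _ X])
    qed
    also have "\<dots> = (\<integral>\<^sup>+\<omega>. ennreal (pmf (K (take n h)) (h ! n)) * indicator {r n} \<omega> \<partial>C 0 n ?u)"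
      using Suc.prems by (intro nn_integral_cong step) (auto simp: sp)
    also have "\<dots> = ennreal (pmf (K (take n h)) (h ! n)) * emeasure (C 0 n ?u) {r n}"
      using X[of n] by (intro nn_integral_cmult_indicator) (use sets_C[OF u, of n] in simp)
    finally show ?case using Suc by (simp add: mult.commute)
  qed
  have "{\<omega>. map \<omega> [0..<length h] = h} = PF.emb UNIV {0..<length h} {r (length h)}"
  proof -
    have "map \<omega> [0..<length h] = h \<longleftrightarrow> restrict \<omega> {0..<length h} = r (length h)" for \<omega>
    proof
      assume *: "map \<omega> [0..<length h] = h"
      have "\<omega> i = h ! i" if "i < length h" for i
        using arg_cong[OF *, of "\<lambda>xs. xs ! i"] that by simp
      then show "restrict \<omega> {0..<length h} = r (length h)" by (auto simp: r_def)
    next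
      assume *: "restrict \<omega> {0..<length h} = r (length h)"
      have "\<omega> i = h ! i" if "i < length h" for i
        using fun_cong[OF *, of i] that by (simp add: r_def)
      then show "map \<omega> [0..<length h] = h" by (intro nth_equalityI) auto
    qed
    then show ?thesis by (auto simp: prod_emb_def)
  qed
  then have "emeasure (path_measure K) {\<omega>. map \<omega> [0..<length h] = h} =
      emeasure (CI {0..<length h}) {r (length h)}"
    using lim[OF _ X[of "length h"]] by (simp add: path_measure_def)
  also have "\<dots> = emeasure (C 0 (length h) ?u) {r (length h)}"
  proof -
    have "PF.emb {0..<length h} {0..<length h} {r (length h)} = {r (length h)}"
      using X[of "length h", THEN sets.sets_into_space]
      by (intro prod_emb_id) (simp add: space_PiM)
    then show ?thesis using emeasure_CI[OF order_refl X[of "length h"]] by simp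
  qed
  finally show ?thesis using C[of "length h"] by simp
qed

lemma sets_path_measure: "sets (path_measure K) = sets (PiM UNIV (\<lambda>_. count_space UNIV))"
  and space_path_measure: "space (path_measure K) = UNIV"
proof -
  interpret Ionescu_Tulcea "\<lambda>n \<omega>. measure_pmf (K (map \<omega> [0..<n]))" "\<lambda>_. count_space UNIV"
    by (rule Ionescu_Tulcea_path)
  show "sets (path_measure K) = sets (PiM UNIV (\<lambda>_. count_space UNIV))"
    by (simp add: path_measure_def)
  show "space (path_measure K) = UNIV"
    by (simp add: path_measure_def space_PiM)
qed

lemma prob_space_path_measure: "prob_space (path_measure K)"
  using path_measure_cylinder[of K "[]"] by (intro prob_spaceI) (simp add: space_path_measure)


section \<open>Markov decision processes\<close>

text \<open>
  The transition distributions and the labels of an MDP are total functions; only their values at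
  states and available actions matter. A run is given by its initial state and by the sequence of
  the pairs of an action and the state it leads to, \<^term>\<open>state_at x0 \<omega> n\<close> being the state
  reached after \<^term>\<open>n\<close> steps. A finite run is a list of such pairs. Runs of a product have the
  same shape, with pairs of an MDP state and an automaton state as states.
\<close>

record ('s, 'act, 'a) mdp =
  mdp_states :: "'s set"
  mdp_init :: 's
  mdp_actions :: "'act set"
  avail :: "'s \<Rightarrow> 'act set"
  kernel :: "'s \<Rightarrow> 'act \<Rightarrow> 's pmf"
  label :: "'s \<Rightarrow> 'act \<Rightarrow> 's \<Rightarrow> 'a"

definition mdp_over :: "'a set \<Rightarrow> ('s, 'act, 'a) mdp \<Rightarrow> bool" where
  "mdp_over \<Sigma> M \<longleftrightarrow>
     finite (mdp_states M) \<and> mdp_init M \<in> mdp_states M \<and> finite (mdp_actions M) \<and>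
     (\<forall>s\<in>mdp_states M. avail M s \<noteq> {} \<and> avail M s \<subseteq> mdp_actions M) \<and>
     (\<forall>s\<in>mdp_states M. \<forall>a\<in>avail M s. set_pmf (kernel M s a) \<subseteq> mdp_states M) \<and>
     (\<forall>s\<in>mdp_states M. \<forall>a\<in>mdp_actions M. \<forall>s'\<in>mdp_states M. label M s a s' \<in> \<Sigma>)"

definition state_at :: "'x \<Rightarrow> (nat \<Rightarrow> 'act \<times> 'x) \<Rightarrow> nat \<Rightarrow> 'x" where
  "state_at x0 \<omega> n = (case n of 0 \<Rightarrow> x0 | Suc k \<Rightarrow> snd (\<omega> k))"

definition last_state :: "'x \<Rightarrow> ('act \<times> 'x) list \<Rightarrow> 'x" where
  "last_state x0 h = state_at x0 ((!) h) (length h)"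

definition finite_run :: "('s, 'act, 'a) mdp \<Rightarrow> ('act \<times> 's) list \<Rightarrow> bool" where
  "finite_run M h \<longleftrightarrow> (\<forall>i<length h.
     let s = state_at (mdp_init M) ((!) h) i; (a, s') = h ! i
     in a \<in> avail M s \<and> pmf (kernel M s a) s' > 0)"

definition strategies :: "('s, 'act, 'a) mdp \<Rightarrow> (('act \<times> 's) list \<Rightarrow> 'act pmf) set" where
  "strategies M = {f. \<forall>h. finite_run M h \<longrightarrow>
     set_pmf (f h) \<subseteq> avail M (last_state (mdp_init M) h)}"

definition step_pmf ::
  "('s, 'act, 'a) mdp \<Rightarrow> (('act \<times> 's) list \<Rightarrow> 'act pmf) \<Rightarrow> ('act \<times> 's) list \<Rightarrow> ('act \<times> 's) pmf"
where
  "step_pmf M f h =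
     do { a \<leftarrow> f h;
          s' \<leftarrow> kernel M (last_state (mdp_init M) h) a;
          return_pmf (a, s') }"

definition labeled_run :: "('s, 'act, 'a) mdp \<Rightarrow> (nat \<Rightarrow> 'act \<times> 's) \<Rightarrow> nat \<Rightarrow> 'a" where
  "labeled_run M \<omega> n = label M (state_at (mdp_init M) \<omega> n) (fst (\<omega> n)) (snd (\<omega> n))"

definition PSem :: "('s::countable, 'act::countable, 'a) mdp \<Rightarrow> ('a, 'q) nba \<Rightarrow> ennreal" where
  "PSem M C = (SUP f\<in>strategies M.
     emeasure (path_measure (step_pmf M f)) {\<omega>. labeled_run M \<omega> \<in> language C})"


section \<open>Products\<close>

text \<open>
  A strategy of the product consists of a choice of an action and of a choice of the automaton
  successor once the action and the MDP successor are known. Both may be randomized and may depend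
  on the whole history of the product.
\<close>

type_synonym ('s, 'act, 'q) product_strategy =
  "(('act \<times> 's \<times> 'q) list \<Rightarrow> 'act pmf) \<times> (('act \<times> 's \<times> 'q) list \<Rightarrow> 'act \<Rightarrow> 's \<Rightarrow> 'q pmf)"

definition product_init :: "('s, 'act, 'a) mdp \<Rightarrow> ('a, 'q) nba \<Rightarrow> 's \<times> 'q" where
  "product_init M C = (mdp_init M, initial_state C)"

definition finite_product_run ::
  "('s, 'act, 'a) mdp \<Rightarrow> ('a, 'q) nba \<Rightarrow> ('act \<times> 's \<times> 'q) list \<Rightarrow> bool" where
  "finite_product_run M C h \<longleftrightarrow> (\<forall>i<length h.
     let (s, q) = state_at (product_init M C) ((!) h) i; (a, s', q') = h ! i
     in a \<in> avail M s \<and> pmf (kernel M s a) s' > 0 \<and> (q, label M s a s', q') \<in> transitions C)"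

definition product_strategies ::
  "('s, 'act, 'a) mdp \<Rightarrow> ('a, 'q) nba \<Rightarrow> ('s, 'act, 'q) product_strategy set" where
  "product_strategies M C = {(f, g). \<forall>h. finite_product_run M C h \<longrightarrow>
     (let (s, q) = last_state (product_init M C) h in
        set_pmf (f h) \<subseteq> avail M s \<and>
        (\<forall>a\<in>avail M s. \<forall>s'\<in>set_pmf (kernel M s a).
           set_pmf (g h a s') \<subseteq> {q'. (q, label M s a s', q') \<in> transitions C}))}"

definition product_step_pmf ::
  "('s, 'act, 'a) mdp \<Rightarrow> ('a, 'q) nba \<Rightarrow> ('s, 'act, 'q) product_strategy \<Rightarrow>
   ('act \<times> 's \<times> 'q) list \<Rightarrow> ('act \<times> 's \<times> 'q) pmf" where
  "product_step_pmf M C fg h =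
     do { a \<leftarrow> fst fg h;
          s' \<leftarrow> kernel M (fst (last_state (product_init M C) h)) a;
          q' \<leftarrow> snd fg h a s';
          return_pmf (a, s', q') }"

definition built_run_accepting ::
  "('s, 'act, 'a) mdp \<Rightarrow> ('a, 'q) nba \<Rightarrow> (nat \<Rightarrow> 'act \<times> 's \<times> 'q) \<Rightarrow> bool" where
  "built_run_accepting M C \<omega> \<longleftrightarrow>
     accepting C (labeled_run M (\<lambda>n. (fst (\<omega> n), fst (snd (\<omega> n)))))
       (\<lambda>n. snd (state_at (product_init M C) \<omega> n))"

definition PSyn ::
  "('s::countable, 'act::countable, 'a) mdp \<Rightarrow> ('a, 'q::countable) nba \<Rightarrow> ennreal" where
  "PSyn M C = (SUP fg\<in>product_strategies M C.
     emeasure (path_measure (product_step_pmf M C fg)) {\<omega>. built_run_accepting M C \<omega>})"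

text \<open>
  The type arguments only provide names for the states and actions of the MDPs: every finite MDP
  has an isomorphic copy over any infinite countable types, and the types are arbitrary in
  theorems about \<open>good_for_mdps\<close>.
\<close>

definition good_for_mdps ::
  "'s::countable itself \<Rightarrow> 'act::countable itself \<Rightarrow> ('a, 'q::countable) nba \<Rightarrow> bool" where
  "good_for_mdps _ _ C \<longleftrightarrow>
     (\<forall>M :: ('s, 'act, 'a) mdp. mdp_over (alphabet C) M \<longrightarrow> PSyn M (complete C) = PSem M C)"

end

theory Submission
  imports Defs
begin

text \<open>
  The duplicator follows the breakpoint construction and takes the additional transition exactly
  when the spoiler reaches a breakpoint that he has fully tracked; if he saw no accepting transition
  between two breakpoints of the spoiler, the second one lets him take one.

  Goodness for MDPs needs no finite-memory strategies. Membership of a word in the language means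
  that for some time and some set of states, jumping there makes the deterministic breakpoint run
  accept; these events are measurable, and once true they stay true at later times. Under an
  arbitrary strategy of the MDP, for each \<open>\<epsilon>\<close> there is a time \<open>N\<close> such that the history up to
  \<open>N\<close> determines a successful target up to probability \<open>\<epsilon>\<close>. Jumping to this target at time \<open>N\<close>
  and simulating the jump by the duplicator's strategy loses at most \<open>\<epsilon>\<close>.
\<close>

section \<open>The simulation strategy\<close>

text \<open>A \<open>gamma_21\<close> step throws states away, so it could cost the duplicator
  states that the spoiler still has. At a tracked breakpoint this is safe: the spoiler's successor
  set \<open>R\<close> then equals her \<open>R'\<close>, and that is contained in the
  \<open>R'\<close> which the duplicator keeps. Right after a breakpoint her second component is
  empty, so it is trivially tracked again; hence the second of two breakpoints is always usable. One
  strategy \<open>follow\<close> serves three times, against a real spoiler (simulation), against a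
  jump known for a given word (language), and against a jump guessed from a finite history (MDPs).
  Late guesses are the obstacle. The sets reached do not depend on when the jump is made, but the
  breakpoints do, because a jump empties the second component. Success for every later jump time is
  therefore demanded, and must be extracted from an accepting run of \<open>B\<close>. The converse
  language inclusion needs a different argument, since a path of sets has to be turned into a single
  run: flagged states and Koenig's lemma.\<close>

lemma konig:
  fixes E :: "nat \<Rightarrow> 'x::finite \<Rightarrow> 'x \<Rightarrow> bool"
  assumes "\<And>m. \<exists>g. g 0 \<in> I \<and> (\<forall>j<m. E j (g j) (g (Suc j)))"
  shows "\<exists>x. x 0 \<in> I \<and> (\<forall>j. E j (x j) (x (Suc j)))"
proof -
  \<comment> \<open>From \<open>x\<close> at level \<open>k\<close> there are paths up to infinitely
    many heights \<open>m\<close>. Infinitely many is the form that passes through the finite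
    pigeonhole, which picks one successor serving infinitely many \<open>m\<close>.\<close>
  define P where "P k x \<longleftrightarrow>
    (\<exists>\<^sub>\<infinity>m. \<exists>g. g k = x \<and> (\<forall>j. k \<le> j \<and> j < m \<longrightarrow> E j (g j) (g (Suc j))))" for k x
  have pigeonhole: "\<exists>x. \<exists>\<^sub>\<infinity>m. R m x" if "\<exists>\<^sub>\<infinity>m::nat. \<exists>x::'x. R m x" for R
    using that by (simp add: frequently_bex_finite[where A = UNIV, simplified])
  have "\<exists>x. \<exists>\<^sub>\<infinity>m. x \<in> I \<and> (\<exists>g. g 0 = x \<and> (\<forall>j<m. E j (g j) (g (Suc j))))"
    by (rule pigeonhole) (unfold INFM_nat, use assms in \<open>metis lessI\<close>)
  then obtain x0 where x0: "x0 \<in> I" "P 0 x0"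
    unfolding P_def by (auto simp: INFM_conjI)
  have ext: "\<exists>y. P (Suc k) y \<and> E k x y" if "P k x" for k x
  proof -
    have "\<exists>\<^sub>\<infinity>m. k < m \<and>
        (\<exists>g. g k = x \<and> (\<forall>j. k \<le> j \<and> j < m \<longrightarrow> E j (g j) (g (Suc j))))"
      using that unfolding P_def
      by (intro frequently_eventually_conj) (auto simp: MOST_nat)
    then have "\<exists>\<^sub>\<infinity>m. \<exists>y. E k x y \<and>
        (\<exists>g. g (Suc k) = y \<and> (\<forall>j. Suc k \<le> j \<and> j < m \<longrightarrow> E j (g j) (g (Suc j))))"
    proof (rule INFM_mono, elim conjE exE)
      fix m g assume "k < m" "g k = x" "\<forall>j. k \<le> j \<and> j < m \<longrightarrow> E j (g j) (g (Suc j))"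
      then show "\<exists>y. E k x y \<and>
          (\<exists>g. g (Suc k) = y \<and> (\<forall>j. Suc k \<le> j \<and> j < m \<longrightarrow> E j (g j) (g (Suc j))))"
        by (intro exI[of _ "g (Suc k)"] conjI exI[of _ g]) auto
    qed
    from pigeonhole[OF this] show ?thesis
      unfolding P_def by (auto simp: INFM_conjI)
  qed
  have "\<exists>x. \<forall>n. P n (x n) \<and> (n = 0 \<longrightarrow> x n = x0) \<and> E n (x n) (x (Suc n))"
    using x0 ext by (intro dependent_nat_choice[where P = "\<lambda>n y. P n y \<and> (n = 0 \<longrightarrow> y = x0)"
      and Q = "\<lambda>n x y. E n x y", simplified conj_assoc]) auto
  then show ?thesis using x0 by metis
qed

section \<open>Runs of automata completed by a sink\<close>

lemma complete_transition_simps [simp]: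
  "(Some q, \<sigma>, Some q') \<in> transitions (complete C) \<longleftrightarrow> (q, \<sigma>, q') \<in> transitions C"
  "(Some q, \<sigma>, None) \<in> transitions (complete C) \<longleftrightarrow>
     q \<in> states C \<and> \<sigma> \<in> alphabet C \<and> (\<forall>q'. (q, \<sigma>, q') \<notin> transitions C)"
  "(None, \<sigma>, x) \<in> transitions (complete C) \<longleftrightarrow> x = None \<and> \<sigma> \<in> alphabet C"
  "(Some q, \<sigma>, Some q') \<in> acc_transitions (complete C) \<longleftrightarrow> (q, \<sigma>, q') \<in> acc_transitions C"
  "(None, \<sigma>, x) \<notin> acc_transitions (complete C)"
  "(x, \<sigma>, None) \<notin> acc_transitions (complete C)"
  by (auto simp: complete_def)

lemma complete_transition_alphabet:
  "buchi C \<Longrightarrow> (x, \<sigma>, y) \<in> transitions (complete C) \<Longrightarrow> \<sigma> \<in> alphabet C"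
  by (auto simp: complete_def buchi_def)

text \<open>The sink is absorbing and touches no accepting transition, so an accepting run can be
  read back in the automaton itself.\<close>

lemma complete_accepting_not_None:
  assumes run: "\<And>n. (r n, w n, r (Suc n)) \<in> transitions (complete C)"
    and acc: "accepting (complete C) w r"
  shows "r n \<noteq> None"
proof
  assume "r n = None"
  then have "r (n + k) = None" for k
  proof (induction k)
    case (Suc k)
    then show ?case using run[of "n + k"] by simp
  qed auto
  moreover obtain k where "(r (n + k), w (n + k), r (Suc (n + k))) \<in> acc_transitions (complete C)"
    using acc unfolding accepting_def INFM_nat_le by (metis le_Suc_ex)
  ultimately show False by simp
qed

lemma language_if_complete_accepting:
  assumes "buchi C" "r 0 \<in> initial (complete C)"
    and run: "\<And>n. (r n, w n, r (Suc n)) \<in> transitions (complete C)"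
    and acc: "accepting (complete C) w r"
  shows "w \<in> language C"
proof -
  define q where "q n = the (r n)" for n
  have q: "r n = Some (q n)" for n
    using complete_accepting_not_None[OF run acc] by (simp add: q_def)
  have "(q n, w n, q (Suc n)) \<in> transitions C" for n
    using run[of n] by (simp add: q)
  moreover have "(\<exists>\<^sub>\<infinity>n. (q n, w n, q (Suc n)) \<in> acc_transitions C)"
    using acc unfolding accepting_def by (simp add: q)
  moreover have "q 0 \<in> initial C" using assms(2) by (auto simp: complete_def q)
  moreover have "w n \<in> alphabet C" for n
    using run[of n] complete_transition_alphabet[OF assms(1)] by blast
  ultimately show ?thesis
    by (auto simp: language_def is_run_def accepting_def)
qed

locale buchi_automaton =
  fixes B :: "('a, 'q::finite) nba"
  assumes buchi: "buchi B"
begin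

text \<open>This is \<open>delta_B\<close> made total: from a pair in \<open>pairs\<close>, an empty
  \<open>R\<close> forces an empty \<open>R'\<close>, and the result is
  \<open>({}, {})\<close>.\<close>

definition bp :: "'q set \<times> 'q set \<Rightarrow> 'a \<Rightarrow> 'q set \<times> 'q set" where
  "bp p \<sigma> = (let (R, R') = delta_R B p \<sigma> in if R = R' then (R, {}) else (R, R'))"

definition brk :: "'q set \<times> 'q set \<Rightarrow> 'a \<Rightarrow> bool" where
  "brk p \<sigma> \<longleftrightarrow> (let (R, R') = delta_R B p \<sigma> in R \<noteq> {} \<and> R = R')"

text \<open>The duplicator moves from \<^term>\<open>p\<close>, the spoiler from \<^term>\<open>t\<close>.\<close>

definition follow :: "'q set \<times> 'q set \<Rightarrow> 'q set \<times> 'q set \<Rightarrow> 'a \<Rightarrow> 'q set \<times> 'q set" where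
  "follow t p \<sigma> =
    (if brk t \<sigma> \<and> fst t \<subseteq> fst p \<and> snd t \<subseteq> snd p then (snd (delta_R B p \<sigma>), {}) else bp p \<sigma>)"

text \<open>The pair \<^term>\<open>({}, {})\<close> plays the role of the rejecting sink.\<close>

definition pairs :: "('q set \<times> 'q set) set" where
  "pairs = insert ({}, {}) (three B)"

definition live :: "'q set \<times> 'q set \<Rightarrow> ('q set \<times> 'q set) option" where
  "live p = (if fst p = {} then None else Some p)"

section \<open>The partial functions in terms of breakpoint steps\<close>

lemma delta_S_empty [simp]: "delta_S B {} \<sigma> = {}" and gamma_S_empty [simp]: "gamma_S B {} \<sigma> = {}"
  by (auto simp: delta_S_def gamma_S_def)

lemma gamma_S_mono: "S' \<subseteq> S \<Longrightarrow> gamma_S B S' \<sigma> \<subseteq> gamma_S B S \<sigma>"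
  by (auto simp: gamma_S_def)

lemma fst_bp [simp]: "fst (bp p \<sigma>) = delta_S B (fst p) \<sigma>"
  by (cases p) (auto simp: bp_def Let_def)

lemma bp_empty [simp]: "bp ({}, {}) \<sigma> = ({}, {})"
  by (auto simp: bp_def)

lemma not_brk_empty [simp]: "\<not> brk ({}, T) \<sigma>"
  by (auto simp: brk_def)

lemma brk_iff: "brk p \<sigma> \<longleftrightarrow> delta_S B (fst p) \<sigma> \<noteq> {} \<and>
    delta_S B (fst p) \<sigma> = delta_S B (snd p) \<sigma> \<union> gamma_S B (fst p) \<sigma>"
  by (cases p) (auto simp: brk_def)

lemma snd_bp: "\<not> brk p \<sigma> \<Longrightarrow> delta_S B (fst p) \<sigma> \<noteq> {} \<Longrightarrow>
    snd (bp p \<sigma>) = delta_S B (snd p) \<sigma> \<union> gamma_S B (fst p) \<sigma>"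
  by (cases p) (auto simp: bp_def brk_def)

lemma snd_bp_subset: "snd (bp p \<sigma>) \<subseteq> delta_S B (snd p) \<sigma> \<union> gamma_S B (fst p) \<sigma>"
  by (cases p) (auto simp: bp_def Let_def)

lemma snd_bp_brk: "brk p \<sigma> \<Longrightarrow> snd (bp p \<sigma>) = {}"
  by (cases p) (auto simp: bp_def brk_def)

lemma delta_B_bp: "delta_B B p \<sigma> = (if delta_S B (fst p) \<sigma> = {} then None else Some (bp p \<sigma>))"
  by (cases p) (auto simp: delta_B_def bp_def Let_def)

lemma gamma_B_bp: "gamma_B B p \<sigma> = (if brk p \<sigma> then Some (bp p \<sigma>) else None)"
  by (cases p) (auto simp: gamma_B_def bp_def brk_def Let_def)

lemma gamma_21_eq: "gamma_21 B p \<sigma> =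
    (if snd (delta_R B p \<sigma>) = {} then None else Some (snd (delta_R B p \<sigma>), {}))"
  by (cases p) auto

declare gamma_21.simps [simp del]

lemma slim_transition_iff: "(p, \<sigma>, p') \<in> transitions (slim_aut B) \<longleftrightarrow>
    p \<in> three B \<and> \<sigma> \<in> alphabet B \<and> (delta_B B p \<sigma> = Some p' \<or> gamma_21 B p \<sigma> = Some p')"
  unfolding slim_aut_def nba.select_convs ndet_def by blast

lemma slim_acc_transition_iff: "(p, \<sigma>, p') \<in> acc_transitions (slim_aut B) \<longleftrightarrow>
    p \<in> three B \<and> \<sigma> \<in> alphabet B \<and> (gamma_B B p \<sigma> = Some p' \<or> gamma_21 B p \<sigma> = Some p')"
  unfolding slim_aut_def nba.select_convs ndet_def by blast

lemma slim_aut_simps [simp]: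
  "alphabet (slim_aut B) = alphabet B" "states (slim_aut B) = three B"
  "initial (slim_aut B) = {(initial B, {})}"
  by (simp_all add: slim_aut_def)

lemma snd_delta_R: "snd (delta_R B p \<sigma>) = delta_S B (snd p) \<sigma> \<union> gamma_S B (fst p) \<sigma>"
  by (cases p) auto

section \<open>Legality of the duplicator's moves\<close>

lemma bp_in_pairs:
  assumes "p \<in> pairs"
  shows "bp p \<sigma> \<in> pairs"
proof (cases "delta_S B (fst p) \<sigma> = {}")
  case False
  then have "p \<in> three B" "delta_B B p \<sigma> = Some (bp p \<sigma>)"
    using assms by (auto simp: pairs_def delta_B_bp)
  then show ?thesis using delta_B_in_three[OF buchi] by (auto simp: pairs_def)
next
  case True
  moreover have "snd p \<subseteq> fst p" using assms by (auto simp: pairs_def three_def)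
  ultimately have "delta_S B (snd p) \<sigma> = {}" "gamma_S B (fst p) \<sigma> = {}"
    using delta_S_mono[of "snd p" "fst p" B \<sigma>] gamma_S_subset[OF buchi, of "fst p" \<sigma>] by auto
  then have "bp p \<sigma> = ({}, {})" using True by (cases p) (simp add: bp_def)
  then show ?thesis by (simp add: pairs_def)
qed

text \<open>A tracked breakpoint of the spoiler would put her nonempty \<open>R'\<close> inside that
  of the duplicator. So \<open>follow\<close> never asks for a \<open>gamma_21\<close> transition
  that is undefined.\<close>

lemma follow_bp_if_gamma_empty:
  assumes "snd (delta_R B p \<sigma>) = {}"
  shows "follow t p \<sigma> = bp p \<sigma>"
  using assms delta_S_mono[of "snd t" "snd p" B \<sigma>] gamma_S_mono[of "fst t" "fst p" \<sigma>]
  by (auto simp: follow_def brk_iff snd_delta_R)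

lemma follow_in_pairs:
  assumes "p \<in> pairs"
  shows "follow t p \<sigma> \<in> pairs"
proof (cases "follow t p \<sigma> = bp p \<sigma>")
  case True
  then show ?thesis using bp_in_pairs[OF assms] by simp
next
  case False
  then have f: "follow t p \<sigma> = (snd (delta_R B p \<sigma>), {})" "snd (delta_R B p \<sigma>) \<noteq> {}"
    using follow_bp_if_gamma_empty[of p \<sigma> t] by (auto simp: follow_def split: if_splits)
  then have "gamma_21 B p \<sigma> = Some (follow t p \<sigma>)" by (simp add: gamma_21_eq)
  moreover have "p \<in> three B" using assms f(2) by (auto simp: pairs_def)
  ultimately show ?thesis using gamma_21_in_three[OF buchi] by (auto simp: pairs_def)
qed

text \<open>The sink may be entered only if both partial functions are undefined; an empty
  \<open>R\<close> ensures this because \<open>R'\<close> is contained in \<open>R\<close>.\<close>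

lemma follow_transition:
  assumes p: "p \<in> pairs" and \<sigma>: "\<sigma> \<in> alphabet B"
  shows "(live p, \<sigma>, live (follow t p \<sigma>)) \<in> transitions (complete (slim_aut B))"
proof (cases "fst p = {}")
  case True
  then have "p = ({}, {})" using p by (auto simp: pairs_def three_def)
  moreover from this have "follow t p \<sigma> = ({}, {})"
    using follow_bp_if_gamma_empty[of p \<sigma> t] by simp
  ultimately show ?thesis using \<sigma> by (simp add: live_def)
next
  case False
  then have p3: "p \<in> three B" using p by (auto simp: pairs_def)
  then have sub: "snd (delta_R B p \<sigma>) \<subseteq> delta_S B (fst p) \<sigma>"
    using gamma_S_subset[OF buchi, of "fst p" \<sigma>] delta_S_mono[of "snd p" "fst p" B \<sigma>]
    by (auto simp: three_def snd_delta_R)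
  show ?thesis
  proof (cases "delta_S B (fst p) \<sigma> = {}")
    case True
    then have e: "snd (delta_R B p \<sigma>) = {}" using sub by auto
    then have "live (follow t p \<sigma>) = None"
      using True follow_bp_if_gamma_empty[of p \<sigma> t] by (simp add: live_def)
    moreover have "\<nexists>q'. (p, \<sigma>, q') \<in> transitions (slim_aut B)"
      using True e by (auto simp: slim_transition_iff delta_B_bp gamma_21_eq)
    ultimately show ?thesis
      using p3 \<sigma> False by (simp add: live_def)
  next
    case R: False
    have "fst (follow t p \<sigma>) \<noteq> {}"
    proof (cases "snd (delta_R B p \<sigma>) = {}")
      case True
      then show ?thesis using R by (simp add: follow_bp_if_gamma_empty)
    next
      case False
      then show ?thesis using R by (simp add: follow_def)
    qed
    moreover have "(p, \<sigma>, follow t p \<sigma>) \<in> transitions (slim_aut B)"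
      using R p3 \<sigma> follow_bp_if_gamma_empty[of p \<sigma> t]
      by (auto simp: slim_transition_iff delta_B_bp gamma_21_eq follow_def split: if_splits)
    ultimately show ?thesis using False by (simp add: live_def)
  qed
qed

lemma follow_acc_transition:
  assumes p: "p \<in> pairs" and \<sigma>: "\<sigma> \<in> alphabet B"
    and "(brk t \<sigma> \<and> fst t \<subseteq> fst p \<and> snd t \<subseteq> snd p) \<or> brk p \<sigma>"
  shows "(live p, \<sigma>, live (follow t p \<sigma>)) \<in> acc_transitions (complete (slim_aut B))"
proof -
  have ne: "snd (delta_R B p \<sigma>) \<noteq> {}"
    using assms(3) delta_S_mono[of "snd t" "snd p" B \<sigma>] gamma_S_mono[of "fst t" "fst p" \<sigma>]
    by (auto simp: brk_iff snd_delta_R)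
  have "p \<noteq> ({}, {})" using ne by auto
  then have p3: "p \<in> three B" and fp: "fst p \<noteq> {}" using p by (auto simp: pairs_def three_def)
  \<comment> \<open>At a breakpoint of the duplicator himself \<open>R\<close> equals
    \<open>R'\<close>, so \<open>gamma_B\<close> and \<open>gamma_21\<close> have the same target
    and both branches of \<open>follow\<close> agree.\<close>
  have "brk p \<sigma> \<Longrightarrow> bp p \<sigma> = (snd (delta_R B p \<sigma>), {})"
    by (auto simp: bp_def brk_def split: prod.splits)
  then have "follow t p \<sigma> = (snd (delta_R B p \<sigma>), {})"
    using assms(3) by (auto simp: follow_def)
  then show ?thesis
    using ne p3 \<sigma> fp by (simp add: live_def slim_acc_transition_iff gamma_21_eq)
qed

text \<open>The critical step is the one that shrinks the duplicator's set to \<open>R'\<close>.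
  There the spoiler is at a breakpoint, her whole successor set is her own \<open>R'\<close>, and
  \<open>R'\<close> is monotone in the pair.\<close>

lemma fst_bp_subset_follow:
  assumes "fst t \<subseteq> fst p"
  shows "fst (bp t \<sigma>) \<subseteq> fst (follow t p \<sigma>)"
proof (cases "brk t \<sigma> \<and> fst t \<subseteq> fst p \<and> snd t \<subseteq> snd p")
  case True
  then have "fst (bp t \<sigma>) = delta_S B (snd t) \<sigma> \<union> gamma_S B (fst t) \<sigma>"
    unfolding brk_iff fst_bp by blast
  also have "\<dots> \<subseteq> snd (delta_R B p \<sigma>)"
    unfolding snd_delta_R using True by (intro Un_mono delta_S_mono gamma_S_mono) auto
  finally show ?thesis using True by (simp add: follow_def)
next
  case False
  then show ?thesis using delta_S_mono[OF assms, of B \<sigma>] by (auto simp: follow_def)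
qed

text \<open>Without a breakpoint on either side no second component is reset, and \<open>R'\<close>
  is monotone in the pair.\<close>

lemma snd_bp_subset_follow:
  assumes "p \<in> pairs" "fst t \<subseteq> fst p" "snd t \<subseteq> snd p" "\<not> brk t \<sigma>" "\<not> brk p \<sigma>"
  shows "snd (bp t \<sigma>) \<subseteq> snd (follow t p \<sigma>)"
proof (cases "delta_S B (fst p) \<sigma> = {}")
  case True
  have "snd p \<subseteq> fst p" using assms(1) by (auto simp: pairs_def three_def)
  then have "delta_S B (snd t) \<sigma> = {}" "delta_S B (fst t) \<sigma> = {}"
    using True assms(2,3) delta_S_mono[of "snd t" "fst p" B \<sigma>] delta_S_mono[of "fst t" "fst p" B \<sigma>]
    by auto
  then show ?thesis
    using snd_bp_subset[of t \<sigma>] gamma_S_subset[OF buchi, of "fst t" \<sigma>] by auto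
next
  case False
  have "snd (bp t \<sigma>) \<subseteq> delta_S B (snd t) \<sigma> \<union> gamma_S B (fst t) \<sigma>" by (rule snd_bp_subset)
  also have "\<dots> \<subseteq> delta_S B (snd p) \<sigma> \<union> gamma_S B (fst p) \<sigma>"
    using assms by (intro Un_mono delta_S_mono gamma_S_mono)
  also have "\<dots> = snd (bp p \<sigma>)" using snd_bp[OF assms(5) False] by simp
  finally show ?thesis using assms(4) by (simp add: follow_def)
qed

lemma follow_accepts:
  assumes p: "\<And>k. p k \<in> pairs" and w: "\<And>k. w k \<in> alphabet B"
    and pstep: "\<And>k. p (Suc k) = follow (t k) (p k) (w k)"
    and tstep: "\<And>k. k \<ge> N \<Longrightarrow> t (Suc k) = bp (t k) (w k)"
    and start: "fst (t N) \<subseteq> fst (p N)"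
    and inf: "\<exists>\<^sub>\<infinity>k. brk (t k) (w k)"
  shows "accepting (complete (slim_aut B)) w (\<lambda>k. live (p k))"
proof (rule ccontr)
  assume "\<not> ?thesis"
  then obtain K where "\<And>k. k \<ge> K \<Longrightarrow>
      (live (p k), w k, live (p (Suc k))) \<notin> acc_transitions (complete (slim_aut B))"
    unfolding accepting_def INFM_nat_le by auto
  then have no: "\<not> ((brk (t k) (w k) \<and> fst (t k) \<subseteq> fst (p k) \<and> snd (t k) \<subseteq> snd (p k)) \<or>
      brk (p k) (w k))" if "k \<ge> K" for k
    using that follow_acc_transition[OF p w, where t = "t k"] unfolding pstep by blast
  have sub: "fst (t k) \<subseteq> fst (p k)" if "k \<ge> N" for k
    using that
  proof (induction k rule: dec_induct)
    case (step k)
    then show ?case using tstep[of k] fst_bp_subset_follow by (simp add: pstep)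
  qed (rule start)
  obtain k1 where k1: "k1 \<ge> max K N" "brk (t k1) (w k1)"
    using inf unfolding INFM_nat_le by blast
  have sub2: "snd (t k) \<subseteq> snd (p k)" if "k \<ge> Suc k1" for k
    using that
  \<comment> \<open>The breakpoint at \<open>k1\<close> empties the spoiler's second component,
    which starts the inclusion. A later breakpoint would find her tracked and so contradict
    \<open>no\<close>; this excludes it in the induction step and refutes the one at
    \<open>k2\<close>.\<close>
  proof (induction k rule: dec_induct)
    case base
    then show ?case using k1 tstep[of k1] snd_bp_brk by simp
  next
    case (step k)
    then have "\<not> brk (p k) (w k)" "\<not> brk (t k) (w k)" "fst (t k) \<subseteq> fst (p k)"
      using no[of k] sub[of k] k1 by auto
    then show ?case
      using snd_bp_subset_follow[OF p] step tstep[of k] k1 by (simp add: pstep)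
  qed
  obtain k2 where "k2 \<ge> Suc k1" "brk (t k2) (w k2)"
    using inf unfolding INFM_nat_le by blast
  then show False using no[of k2] sub[of k2] sub2[of k2] k1 by auto
qed

section \<open>The language of the slim automaton\<close>

lemma acc_transition: "(q, \<sigma>, q') \<in> acc_transitions B \<Longrightarrow> (q, \<sigma>, q') \<in> transitions B"
  using buchi by (auto simp: buchi_def)

lemma snd_bp_subset_fst: "snd p \<subseteq> fst p \<Longrightarrow> snd (bp p \<sigma>) \<subseteq> fst (bp p \<sigma>)"
  using snd_bp_subset[of p \<sigma>] gamma_S_subset[OF buchi, of "fst p" \<sigma>]
    delta_S_mono[of "snd p" "fst p" B \<sigma>] by auto

lemma in_delta_S: "q \<in> S \<Longrightarrow> (q, \<sigma>, q') \<in> transitions B \<Longrightarrow> q' \<in> delta_S B S \<sigma>"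
  and in_gamma_S: "q \<in> S \<Longrightarrow> (q, \<sigma>, q') \<in> acc_transitions B \<Longrightarrow> q' \<in> gamma_S B S \<sigma>"
  by (auto simp: delta_S_def gamma_S_def)

text \<open>
  The part of a run of the limit-deterministic automaton that jumps to \<^term>\<open>(T, {})\<close> at
  time \<^term>\<open>N\<close>, padded with the sink before the jump.
\<close>

primrec tseq :: "(nat \<Rightarrow> 'a) \<Rightarrow> nat \<Rightarrow> 'q set \<Rightarrow> nat \<Rightarrow> 'q set \<times> 'q set" where
  "tseq w N T 0 = (if N = 0 then (T, {}) else ({}, {}))"
| "tseq w N T (Suc k) = (if Suc k = N then (T, {}) else bp (tseq w N T k) (w k))"

primrec pseq :: "(nat \<Rightarrow> 'a) \<Rightarrow> nat \<Rightarrow> 'q set \<Rightarrow> nat \<Rightarrow> 'q set \<times> 'q set" where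
  "pseq w N T 0 = (initial B, {})"
| "pseq w N T (Suc k) = follow (tseq w N T k) (pseq w N T k) (w k)"

definition jump_accepts :: "(nat \<Rightarrow> 'a) \<Rightarrow> nat \<Rightarrow> 'q set \<Rightarrow> bool" where
  "jump_accepts w N T \<longleftrightarrow> (\<exists>\<^sub>\<infinity>k. brk (tseq w N T k) (w k))"

text \<open>The powerset run from the initial states, read off \<open>tseq\<close> so that the facts
  about its first components apply.\<close>

definition reach :: "(nat \<Rightarrow> 'a) \<Rightarrow> nat \<Rightarrow> 'q set" where
  "reach w k = fst (tseq w 0 (initial B) k)"

text \<open>
  Jumping to the successors of \<^term>\<open>T\<close> must succeed at every later time as well, because the
  product strategy only jumps once it has observed enough of the word.
\<close>

definition witness :: "(nat \<Rightarrow> 'a) \<Rightarrow> nat \<Rightarrow> 'q set \<Rightarrow> bool" where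
  "witness w n T \<longleftrightarrow> T \<subseteq> reach w n \<and> (\<forall>m\<ge>n. jump_accepts w m (fst (tseq w n T m)))"

lemma tseq_before: "k < N \<Longrightarrow> tseq w N T k = ({}, {})"
  by (induction k) auto

lemma tseq_at: "tseq w N T N = (T, {})"
  by (cases N) auto

text \<open>First components just follow \<open>delta_S\<close>, whatever the breakpoints, so
  restarting at \<open>m\<close> from the set reached there leaves them unchanged. Second components
  are emptied by the restart and may differ.\<close>

lemma fst_tseq_shift:
  "n \<le> m \<Longrightarrow> m \<le> k \<Longrightarrow> fst (tseq w m (fst (tseq w n T m)) k) = fst (tseq w n T k)"
proof (rotate_tac 1, induction k rule: dec_induct)
  case base
  then show ?case by (simp add: tseq_at)
qed auto

lemma fst_tseq_mono: "N \<le> k \<Longrightarrow> T \<subseteq> T' \<Longrightarrow> fst (tseq w N T k) \<subseteq> fst (tseq w N T' k)"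
proof (induction k rule: dec_induct)
  case base
  then show ?case by (simp add: tseq_at)
next
  case (step k)
  then show ?case by (simp add: delta_S_mono)
qed

lemma snd_tseq_subset: "snd (tseq w N T k) \<subseteq> fst (tseq w N T k)"
  by (induction k) (auto simp del: fst_bp dest: subsetD[OF snd_bp_subset_fst])

lemma initial_in_three: "(initial B, {}) \<in> three B"
  using buchi by (auto simp: buchi_def three_def)

lemma pseq_in_pairs: "pseq w N T k \<in> pairs"
  using initial_in_three by (induction k) (auto simp: follow_in_pairs, auto simp: pairs_def)

text \<open>Until the jump the virtual spoiler sits in \<open>({}, {})\<close>, which has no
  breakpoint, so \<open>follow\<close> is \<open>bp\<close> and the duplicator drops no
  state.\<close>

lemma fst_pseq_before: "k \<le> N \<Longrightarrow> fst (pseq w N T k) = reach w k"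
proof (induction k)
  case (Suc k)
  then show ?case by (simp add: tseq_before follow_def reach_def)
qed (simp add: reach_def)

lemma witness_subset_reach:
  assumes "T \<subseteq> reach w n" "n \<le> m"
  shows "fst (tseq w n T m) \<subseteq> reach w m"
proof -
  have "fst (tseq w n T m) \<subseteq> fst (tseq w n (reach w n) m)"
    using assms by (intro fst_tseq_mono)
  also have "\<dots> = reach w m"
    unfolding reach_def using assms(2) by (intro fst_tseq_shift) auto
  finally show ?thesis .
qed

lemma pseq_transition:
  "w k \<in> alphabet B \<Longrightarrow>
    (live (pseq w N T k), w k, live (pseq w N T (Suc k))) \<in> transitions (complete (slim_aut B))"
  using follow_transition[OF pseq_in_pairs] by simp

lemma pseq_accepting:
  assumes "jump_accepts w N T" "T \<subseteq> reach w N" "\<And>k. w k \<in> alphabet B"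
  shows "accepting (complete (slim_aut B)) w (\<lambda>k. live (pseq w N T k))"
  using assms fst_pseq_before[of N N w T]
  by (intro follow_accepts[where t = "tseq w N T" and N = N])
    (auto simp: pseq_in_pairs tseq_at jump_accepts_def)

lemma live_initial: "live (initial B, {}) = Some (initial B, {})"
  using buchi by (auto simp: live_def buchi_def)

lemma language_slim_if_jump_accepts:
  assumes "jump_accepts w N T" "T \<subseteq> reach w N" "\<And>k. w k \<in> alphabet B"
  shows "w \<in> language (slim_aut B)"
proof (rule language_if_complete_accepting[OF buchi_slim_aut[OF buchi]])
  show "live (pseq w N T 0) \<in> initial (complete (slim_aut B))"
    by (simp add: live_initial complete_def)
qed (use assms pseq_transition pseq_accepting in auto)

text \<open>
  For an accepting run \<^term>\<open>r\<close>, the sets reached from \<^term>\<open>r n\<close> shrink as \<^term>\<open>n\<close> grows.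
  Once their eventual size is minimal, every later state of the run reaches all of them in the
  end, in particular the state after an accepting transition, which forces a breakpoint.
\<close>

lemma language_imp_witness:
  assumes "w \<in> language B"
  shows "\<exists>n T. witness w n T"
proof -
  obtain r where r0: "r 0 \<in> initial B"
    and run: "\<And>n. (r n, w n, r (Suc n)) \<in> transitions B"
    and acc: "\<exists>\<^sub>\<infinity>n. (r n, w n, r (Suc n)) \<in> acc_transitions B"
    using assms by (auto simp: language_def is_run_def accepting_def)
  define R where "R n k = fst (tseq w n {r n} k)" for n k
  have rR: "r k \<in> R n k" if "n \<le> k" for n k
    using that
  proof (induction k rule: dec_induct)
    case base
    then show ?case by (simp add: R_def tseq_at)
  next
    case (step k)
    then show ?case using in_delta_S[OF _ run[of k]] by (simp add: R_def)
  qed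
  have R_anti: "R m k \<subseteq> R n k" if "n \<le> m" "m \<le> k" for n m k
    using fst_tseq_mono[OF that(2), of "{r m}" "R n m" w] rR[OF that(1)] fst_tseq_shift[OF that]
    by (simp add: R_def)
  \<comment> \<open>The least such \<open>c\<close> is the minimum over \<open>n\<close> of the
    lower limit of \<open>card (R n k)\<close>; the \<open>n\<close> obtained below attains
    it.\<close>
  define P where "P c \<longleftrightarrow> (\<exists>n. \<exists>\<^sub>\<infinity>k. card (R n k) \<le> c)" for c
  have "P (card (UNIV :: 'q set))"
    unfolding P_def INFM_nat_le by (meson card_mono finite order_refl subset_UNIV)
  then have "P (LEAST c. P c)" by (rule LeastI)
  then obtain n where n: "\<exists>\<^sub>\<infinity>k. card (R n k) \<le> (LEAST c. P c)" unfolding P_def by blast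
  \<comment> \<open>If \<open>R m k\<close> stayed strictly inside \<open>R n k\<close> from some
    time on, its size would infinitely often be below the least \<open>c\<close>.\<close>
  have stable: "\<exists>k\<ge>K. R m k = R n k" if m: "n \<le> m" for m K
  proof (rule ccontr)
    assume *: "\<not> ?thesis"
    have less: "card (R m k) < card (R n k)" if "k \<ge> max m K" for k
      using that * R_anti[OF m, of k] by (intro psubset_card_mono) auto
    have ex: "\<exists>k\<ge>j. card (R m k) < (LEAST c. P c)" for j
    proof -
      obtain k where "k \<ge> max j (max m K)" "card (R n k) \<le> (LEAST c. P c)"
        using n unfolding INFM_nat_le by blast
      then show ?thesis using less[of k] by (intro exI[of _ k]) auto
    qed
    then have pos: "(LEAST c. P c) > 0" by fastforce
    have "\<exists>k\<ge>j. card (R m k) \<le> (LEAST c. P c) - 1" for j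
    proof -
      obtain k where "k \<ge> j" "card (R m k) < (LEAST c. P c)" using ex by blast
      then show ?thesis by (intro exI[of _ k]) auto
    qed
    then have "P ((LEAST c. P c) - 1)" unfolding P_def INFM_nat_le by blast
    then show False using not_less_Least[of "(LEAST c. P c) - 1" P] pos by simp
  qed
  have "{r n} \<subseteq> reach w n"
  proof (induction n)
    case (Suc n)
    then show ?case using in_delta_S[OF _ run[of n]] by (simp add: reach_def)
  qed (use r0 in \<open>simp add: reach_def\<close>)
  moreover have "jump_accepts w m (R n m)" if m: "n \<le> m" for m
  proof (rule ccontr)
    define t where "t = tseq w m (R n m)"
    have ft: "fst (t k) = R n k" if "k \<ge> m" for k
      using fst_tseq_shift[OF m that] by (simp add: t_def R_def)
    have t: "t (Suc k) = bp (t k) (w k)" if "k \<ge> m" for k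
      using that by (simp add: t_def)
    assume "\<not> ?thesis"
    then obtain K where K: "\<And>k. k \<ge> K \<Longrightarrow> \<not> brk (t k) (w k)"
      by (auto simp: jump_accepts_def INFM_nat_le t_def)
    have snd_t: "snd (t (Suc k)) = delta_S B (snd (t k)) (w k) \<union> gamma_S B (fst (t k)) (w k)"
      if "k \<ge> max K m" for k
    proof -
      have "fst (t (Suc k)) \<noteq> {}" using ft[of "Suc k"] rR[of n "Suc k"] m that by auto
      then show ?thesis using snd_bp[OF K[of k]] t[of k] that by simp
    qed
    obtain j where j: "j \<ge> max K m" "(r j, w j, r (Suc j)) \<in> acc_transitions B"
      using acc unfolding INFM_nat_le by blast
    have R_snd: "R (Suc j) k \<subseteq> snd (t k)" if "k \<ge> Suc j" for k
      using that
    proof (induction k rule: dec_induct)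
      case base
      have "r (Suc j) \<in> gamma_S B (fst (t j)) (w j)"
        using in_gamma_S[OF rR[of n j] j(2)] ft[of j] j(1) m by simp
      then show ?case using snd_t[OF j(1)] by (simp add: R_def tseq_at)
    next
      case (step k)
      then show ?case
        using snd_t[of k] j(1) delta_S_mono[of "R (Suc j) k" "snd (t k)" B "w k"]
        by (auto simp: R_def)
    qed
    \<comment> \<open>\<open>Suc (Suc j)\<close> leaves room for a predecessor \<open>k\<close> of
      \<open>k'\<close> with \<open>k \<ge> Suc j\<close>; the forced breakpoint is the step from
      \<open>k\<close> to \<open>k'\<close>.\<close>
    obtain k' where k': "k' \<ge> Suc (Suc j)" "R (Suc j) k' = R n k'"
      using stable[of "Suc j" "Suc (Suc j)"] j(1) m by auto
    then obtain k where k: "k' = Suc k" "k \<ge> Suc j" by (cases k') auto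
    have "fst (t (Suc k)) = snd (t (Suc k))"
      using R_snd[of k'] ft[of k'] k' k j(1) snd_tseq_subset[of w m "R n m" "Suc k"]
      by (auto simp: t_def)
    moreover have "fst (t (Suc k)) \<noteq> {}" using ft[of "Suc k"] rR[of n "Suc k"] m j(1) k(2) by auto
    ultimately have "brk (t k) (w k)"
      using snd_t[of k] t[of k] j(1) k(2) unfolding brk_iff by simp
    then show False using K[of k] j(1) k(2) by simp
  qed
  ultimately have "witness w n {r n}" by (auto simp: witness_def R_def)
  then show ?thesis by blast
qed

text \<open>
  The flag of a path records that it has taken an accepting
  transition since the last reset, so that flagged states are tracked by the second component.
\<close>

lemma language_slim_subset: "language (slim_aut B) \<subseteq> language B"
proof
  fix w assume "w \<in> language (slim_aut B)"
  then obtain p where w: "\<And>n. w n \<in> alphabet B" and p0: "p 0 = (initial B, {})"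
    and run: "\<And>n. (p n, w n, p (Suc n)) \<in> transitions (slim_aut B)"
    and acc: "\<exists>\<^sub>\<infinity>n. (p n, w n, p (Suc n)) \<in> acc_transitions (slim_aut B)"
    by (auto simp: language_def is_run_def accepting_def)
  define a where "a n \<longleftrightarrow> (p n, w n, p (Suc n)) \<in> acc_transitions (slim_aut B)" for n
  \<comment> \<open>Both kinds of accepting transition lead to \<open>(R', {})\<close>, since
    \<open>gamma_B\<close> is defined only where \<open>R\<close> equals \<open>R'\<close>.\<close>
  have reset: "p (Suc n) = (delta_S B (snd (p n)) (w n) \<union> gamma_S B (fst (p n)) (w n), {})"
    if "a n" for n
  proof -
    have "bp (p n) (w n) = (delta_S B (snd (p n)) (w n) \<union> gamma_S B (fst (p n)) (w n), {})"
      if "brk (p n) (w n)"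
      using that snd_bp_brk[OF that] unfolding brk_iff by (intro prod_eqI) simp_all
    then show ?thesis
      using \<open>a n\<close> by (auto simp: a_def slim_acc_transition_iff gamma_B_bp gamma_21_eq snd_delta_R
          split: if_splits)
  qed
  have noreset: "fst (p (Suc n)) = delta_S B (fst (p n)) (w n)"
    "snd (p (Suc n)) = delta_S B (snd (p n)) (w n) \<union> gamma_S B (fst (p n)) (w n)"
    if "\<not> a n" for n
  proof -
    have "delta_B B (p n) (w n) = Some (p (Suc n))" "\<not> brk (p n) (w n)"
      using that run[of n] by (auto simp: a_def slim_transition_iff slim_acc_transition_iff
          gamma_B_bp delta_B_bp split: if_splits)
    then have "\<not> brk (p n) (w n)" "delta_S B (fst (p n)) (w n) \<noteq> {}" "p (Suc n) = bp (p n) (w n)"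
      by (simp_all add: delta_B_bp split: if_splits)
    then show "fst (p (Suc n)) = delta_S B (fst (p n)) (w n)"
      "snd (p (Suc n)) = delta_S B (snd (p n)) (w n) \<union> gamma_S B (fst (p n)) (w n)"
      by (simp_all add: snd_bp)
  qed
  define L where "L n = {(q, f). q \<in> (if f then snd (p n) else fst (p n))}" for n
  \<comment> \<open>At an accepting step of \<open>p\<close> only \<open>R'\<close> survives: an
    unflagged path must use an accepting transition there, a flagged one may use any, and the flag
    is cleared. At other steps an accepting transition may set the flag.\<close>
  define E where "E n x y \<longleftrightarrow>
    (if a n then \<not> snd y \<and>
       (fst x, w n, fst y) \<in> (if snd x then transitions B else acc_transitions B)
     else (snd x = snd y \<and> (fst x, w n, fst y) \<in> transitions B) \<or>
       (\<not> snd x \<and> snd y \<and> (fst x, w n, fst y) \<in> acc_transitions B))" for n x y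
  \<comment> \<open>Every element of a layer comes from the layer before, so finite paths are built
    backwards from any state of layer \<open>m\<close>; \<open>konig\<close> then yields an infinite
    one.\<close>
  have pred: "\<exists>x\<in>L n. E n x (q, f)" if q: "(q, f) \<in> L (Suc n)" for n q f
  proof (cases "a n")
    case True
    then have "\<not> f" "q \<in> delta_S B (snd (p n)) (w n) \<or> q \<in> gamma_S B (fst (p n)) (w n)"
      using q reset[OF True] by (auto simp: L_def split: if_splits)
    then consider q' where "(q', True) \<in> L n" "(q', w n, q) \<in> transitions B"
      | q' where "(q', False) \<in> L n" "(q', w n, q) \<in> acc_transitions B"
      by (auto simp: L_def delta_S_def gamma_S_def)
    then show ?thesis
      using True \<open>\<not> f\<close> by cases (force simp: E_def)+
  next
    case False
    have "q \<in> delta_S B (if f then snd (p n) else fst (p n)) (w n) \<or>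
        f \<and> q \<in> gamma_S B (fst (p n)) (w n)"
      using q noreset[OF False] by (auto simp: L_def split: if_splits)
    then consider q' where "(q', f) \<in> L n" "(q', w n, q) \<in> transitions B"
      | q' where f "(q', False) \<in> L n" "(q', w n, q) \<in> acc_transitions B"
      by (auto simp: L_def delta_S_def gamma_S_def)
    then show ?thesis
      using False by cases (force simp: E_def)+
  qed
  have path: "\<exists>g. g m = x \<and> g 0 \<in> L 0 \<and> (\<forall>j<m. E j (g j) (g (Suc j)))" if "x \<in> L m" for m x
    using that
  proof (induction m arbitrary: x)
    case (Suc m)
    obtain y where y: "y \<in> L m" "E m y x" using pred[of "fst x" "snd x" m] Suc.prems by auto
    obtain g where "g m = y" "g 0 \<in> L 0" "\<forall>j<m. E j (g j) (g (Suc j))" using Suc.IH[OF y(1)] by blast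
    then show ?case using y by (intro exI[of _ "g(Suc m := x)"]) (auto simp: less_Suc_eq)
  qed auto
  have "\<exists>g. g 0 \<in> L 0 \<and> (\<forall>j<m. E j (g j) (g (Suc j)))" for m
  proof -
    have "p m \<in> three B" using run[of m] by (simp add: slim_transition_iff)
    then have "fst (p m) \<noteq> {}" by (auto simp: three_def)
    then obtain q where "q \<in> fst (p m)" by blast
    then have "(q, False) \<in> L m" by (simp add: L_def)
    from path[OF this] show ?thesis by blast
  qed
  from konig[OF this] obtain x where x0: "x 0 \<in> L 0" and x: "\<And>j. E j (x j) (x (Suc j))" by blast
  define r where "r n = fst (x n)" for n
  have "r 0 \<in> initial B" using x0 p0 by (auto simp: r_def L_def split: if_splits)
  moreover have "(r n, w n, r (Suc n)) \<in> transitions B" for n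
    using x[of n] by (auto simp: E_def r_def acc_transition split: if_splits)
  moreover have "\<exists>\<^sub>\<infinity>n. (r n, w n, r (Suc n)) \<in> acc_transitions B"
  proof (rule ccontr)
    assume "\<not> ?thesis"
    then obtain K where K: "\<And>n. n \<ge> K \<Longrightarrow> (r n, w n, r (Suc n)) \<notin> acc_transitions B"
      by (auto simp: INFM_nat_le)
    \<comment> \<open>Two accepting steps of \<open>p\<close> are used: the first clears the flag,
      and at the second an unflagged path has to take an accepting transition of
      \<open>B\<close>.\<close>
    obtain k1 where k1: "k1 \<ge> K" "a k1" using acc unfolding INFM_nat_le a_def by blast
    have flag: "\<not> snd (x k)" if "k \<ge> Suc k1" for k
      using that
    proof (induction k rule: dec_induct)
      case base
      then show ?case using x[of k1] k1 by (simp add: E_def)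
    next
      case (step k)
      then show ?case using x[of k] K[of k] k1 by (auto simp: E_def r_def split: if_splits)
    qed
    obtain k2 where k2: "k2 \<ge> Suc k1" "a k2" using acc unfolding INFM_nat_le a_def by blast
    then show False using x[of k2] flag[of k2] K[of k2] k1 by (simp add: E_def r_def)
  qed
  ultimately show "w \<in> language B"
    using w by (auto simp: language_def is_run_def accepting_def)
qed

text \<open>The inclusions form a circle through the language of \<open>B\<close>. The existential
  over runs becomes one over countably many pairs of \<open>n\<close> and \<open>T\<close>, from
  which measurability follows.\<close>

lemma language_slim_iff: "w \<in> language (slim_aut B) \<longleftrightarrow>
    (\<forall>n. w n \<in> alphabet B) \<and> (\<exists>n T. witness w n T)"
proof
  assume *: "w \<in> language (slim_aut B)"
  have "\<exists>n T. witness w n T"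
    using * language_slim_subset by (intro language_imp_witness) auto
  moreover have "\<forall>n. w n \<in> alphabet B" using * by (simp add: language_def)
  ultimately show "(\<forall>n. w n \<in> alphabet B) \<and> (\<exists>n T. witness w n T)" by simp
next
  assume *: "(\<forall>n. w n \<in> alphabet B) \<and> (\<exists>n T. witness w n T)"
  then obtain n T where "witness w n T" by blast
  then have "jump_accepts w n T" "T \<subseteq> reach w n" by (auto simp: witness_def tseq_at)
  then show "w \<in> language (slim_aut B)" using * language_slim_if_jump_accepts by blast
qed

lemma language_slim: "language (slim_aut B) = language B"
proof
  show "language B \<subseteq> language (slim_aut B)"
  proof
    fix w assume w: "w \<in> language B"
    then have "\<forall>n. w n \<in> alphabet B" by (simp add: language_def)
    then show "w \<in> language (slim_aut B)"
      using language_imp_witness[OF w] by (simp add: language_slim_iff)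
  qed
qed (rule language_slim_subset)

lemma slim_slim_aut: "slim (slim_aut B)"
  unfolding slim_def slim_aut_simps
proof (intro ballI)
  fix p \<sigma>
  have sub: "{q'. (p, \<sigma>, q') \<in> transitions (slim_aut B)} \<subseteq>
      {the (delta_B B p \<sigma>), the (gamma_21 B p \<sigma>)}"
    by (auto simp: slim_transition_iff)
  have "card {the (delta_B B p \<sigma>), the (gamma_21 B p \<sigma>)} \<le> 2"
    using card_insert_le_m1[of 2 "{the (gamma_21 B p \<sigma>)}" "the (delta_B B p \<sigma>)"] by simp
  then show "finite {q'. (p, \<sigma>, q') \<in> transitions (slim_aut B)} \<and>
      card {q'. (p, \<sigma>, q') \<in> transitions (slim_aut B)} \<le> 2"
    using card_mono[OF _ sub] finite_subset[OF sub] by simp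
qed

section \<open>The simulation game\<close>

text \<open>A spoiler in her powerset phase or in the sink has no breakpoint;
  \<open>({}, {})\<close> expresses this and turns \<open>follow\<close> into
  \<open>bp\<close>.\<close>

definition virtual :: "('q set + 'q set \<times> 'q set) option \<Rightarrow> 'q set \<times> 'q set" where
  "virtual x = (case x of Some (Inr t) \<Rightarrow> t | _ \<Rightarrow> ({}, {}))"

lemma follow_empty: "follow ({}, {}) p \<sigma> = bp p \<sigma>"
  by (simp add: follow_def)

definition unlive :: "('q set \<times> 'q set) option \<Rightarrow> 'q set \<times> 'q set" where
  "unlive x = (case x of None \<Rightarrow> ({}, {}) | Some p \<Rightarrow> p)"

lemma unlive_live: "p \<in> pairs \<Longrightarrow> unlive (live p) = p"
  by (auto simp: unlive_def live_def pairs_def three_def)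

lemma limit_det_Inl_transition:
  assumes "(Inl S, \<sigma>, y) \<in> transitions (limit_det B)"
  shows "y = Inl (delta_S B S \<sigma>) \<or> (\<exists>T. y = Inr (T, {}) \<and> T \<subseteq> delta_S B S \<sigma>)"
  using assms by (auto simp: limit_det_def ndet_def Delta_SB_def)

lemma limit_det_Inr_transition:
  assumes "(Inr t, \<sigma>, y) \<in> transitions (limit_det B)"
  shows "y = Inr (bp t \<sigma>)"
  using assms by (auto simp: limit_det_def ndet_def delta_B_bp split: if_splits)

lemma limit_det_acc_transition:
  assumes "(x, \<sigma>, y) \<in> acc_transitions (limit_det B)"
  obtains t where "x = Inr t" "brk t \<sigma>"
  using assms by (auto simp: limit_det_def ndet_def gamma_B_bp split: if_splits)

lemma simulates_slim_limit_det: "simulates (slim_aut B) (limit_det B)"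
  unfolding simulates_def duplicator_wins_def
proof (intro exI allI impI)
  \<comment> \<open>The two current states are read off the last round. The spoiler's state before
    her move and the letter already decide whether her step is a breakpoint.\<close>
  define strat where "strat h \<sigma> u =
    live (follow (virtual (if h = [] then Some (Inl (initial B)) else fst (snd (last h))))
      (unlive (if h = [] then Some (initial B, {}) else snd (snd (last h)))) \<sigma>)"
    for h :: "('a \<times> ('q set + 'q set \<times> 'q set) option \<times> ('q set \<times> 'q set) option) list"
      and \<sigma> and u :: "('q set + 'q set \<times> 'q set) option"
  fix w r r'
  assume "r 0 = initial_state (complete (limit_det B))"
    and run: "\<forall>n. (r n, w n, r (Suc n)) \<in> transitions (complete (limit_det B))"
    and "r' 0 = initial_state (complete (slim_aut B))"
    and r': "\<forall>n. r' (Suc n) =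
      strat (map (\<lambda>i. (w i, r (Suc i), r' (Suc i))) [0..<n]) (w n) (r (Suc n))"
  then have r0: "r 0 = Some (Inl (initial B))" and r'0: "r' 0 = Some (initial B, {})"
    by (simp_all add: initial_state_def complete_def limit_det_def)
  have w: "w n \<in> alphabet B" for n
    using complete_transition_alphabet[OF buchi_limit_det[OF buchi] run[rule_format, of n]]
    by (simp add: limit_det_def)
  define p where "p n = unlive (r' n)" for n
  have step: "r' (Suc n) = live (follow (virtual (r n)) (p n) (w n))" for n
  proof (cases n)
    case 0
    then show ?thesis using r'[rule_format, of 0] by (simp add: strat_def p_def r0 r'0)
  next
    case (Suc m)
    have "r' (Suc n) = strat (map (\<lambda>i. (w i, r (Suc i), r' (Suc i))) [0..<n]) (w n) (r (Suc n))"
      using r' by blast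
    then show ?thesis unfolding Suc strat_def p_def by simp
  qed
  have in_pairs: "p n \<in> pairs" for n
  proof (induction n)
    case 0
    then show ?case using initial_in_three by (simp add: p_def r'0 unlive_def pairs_def)
  next
    case (Suc n)
    then show ?case
      unfolding p_def[of "Suc n"] step[of n] by (simp add: unlive_live follow_in_pairs)
  qed
  have pstep: "p (Suc n) = follow (virtual (r n)) (p n) (w n)" for n
    unfolding p_def[of "Suc n"] step[of n] by (simp add: unlive_live follow_in_pairs in_pairs)
  have live_p: "r' n = live (p n)" for n
    by (cases n) (simp_all add: step pstep r'0 live_initial p_def[of 0] unlive_def)
  have "(r' n, w n, r' (Suc n)) \<in> transitions (complete (slim_aut B))" for n
    unfolding live_p pstep by (rule follow_transition[OF in_pairs w])
  moreover have "accepting (complete (slim_aut B)) w r'"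
    if acc: "accepting (complete (limit_det B)) w r"
  proof -
    define q where "q n = the (r n)" for n
    have q: "r n = Some (q n)" for n
      using complete_accepting_not_None[OF _ acc] run by (simp add: q_def)
    have tr: "(q n, w n, q (Suc n)) \<in> transitions (limit_det B)" for n
      using run[rule_format, of n] by (simp add: q)
    have inf: "\<exists>\<^sub>\<infinity>n. \<exists>t. q n = Inr t \<and> brk t (w n)"
      using acc unfolding accepting_def
      by (elim INFM_mono) (auto simp: q elim: limit_det_acc_transition)
    define N where "N = (LEAST n. \<exists>t. q n = Inr t)"
    have "\<exists>n t. q n = Inr t" using inf unfolding INFM_nat_le by blast
    then have N: "\<exists>t. q N = Inr t" unfolding N_def by (rule LeastI_ex)
    moreover have "q 0 = Inl (initial B)" using r0 by (simp add: q)
    ultimately obtain N' where N': "N = Suc N'" by (cases N) auto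
    \<comment> \<open>Before the jump both players hold the same set, so any jump target lies in the
      duplicator's next set.\<close>
    have Inl: "q k = Inl (fst (p k))" if "k \<le> N'" for k
      using that
    proof (induction k)
      case 0
      then show ?case using r0 r'0 by (simp add: q p_def unlive_def)
    next
      case (Suc k)
      then have k: "q k = Inl (fst (p k))" by simp
      have "\<not> (\<exists>t. q (Suc k) = Inr t)"
        using Suc.prems N' unfolding N_def by (intro not_less_Least) simp
      moreover have "fst (p (Suc k)) = delta_S B (fst (p k)) (w k)"
        by (simp add: pstep q k virtual_def follow_empty)
      ultimately show ?case
        using limit_det_Inl_transition[OF tr[of k, unfolded k]] by auto
    qed
    have "fst (p N) = delta_S B (fst (p N')) (w N')"
      by (simp add: N' pstep q Inl virtual_def follow_empty)
    moreover obtain T where "q N = Inr (T, {})" "T \<subseteq> delta_S B (fst (p N')) (w N')"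
      using limit_det_Inl_transition[OF tr[of N', unfolded Inl[OF order_refl]]] N
      unfolding N'[symmetric] by auto
    ultimately have start: "fst (virtual (r N)) \<subseteq> fst (p N)"
      by (simp add: q virtual_def)
    have Inr: "\<exists>t. q k = Inr t" if "k \<ge> N" for k
      using that
    proof (induction k rule: dec_induct)
      case (step k)
      then obtain t where "q k = Inr t" by blast
      then show ?case using limit_det_Inr_transition[of t "w k" "q (Suc k)"] tr[of k] by simp
    qed (rule N)
    have "accepting (complete (slim_aut B)) w (\<lambda>n. live (p n))"
    proof (rule follow_accepts[where t = "\<lambda>n. virtual (r n)" and N = N])
      fix k assume "N \<le> k"
      then obtain t where "q k = Inr t" using Inr by blast
      then show "virtual (r (Suc k)) = bp (virtual (r k)) (w k)"
        using limit_det_Inr_transition[of t "w k" "q (Suc k)"] tr[of k] by (simp add: q virtual_def)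
    next
      show "\<exists>\<^sub>\<infinity>k. brk (virtual (r k)) (w k)"
        using inf by (elim INFM_mono) (auto simp: q virtual_def)
    qed (use in_pairs w pstep start in simp_all)
    then show ?thesis by (simp add: accepting_def live_p)
  qed
  ultimately show "(\<forall>n. (r' n, w n, r' (Suc n)) \<in> transitions (complete (slim_aut B))) \<and>
      (accepting (complete (slim_aut B)) w r' \<or> \<not> accepting (complete (limit_det B)) w r)"
    by blast
qed

end

section \<open>Random paths and their finite segments\<close>

abbreviation segment :: "(nat \<Rightarrow> 'x) \<Rightarrow> nat \<Rightarrow> 'x list" where
  "segment \<omega> n \<equiv> map \<omega> [0..<n]"

abbreviation paths :: "(nat \<Rightarrow> 'x) measure" where
  "paths \<equiv> PiM UNIV (\<lambda>_. count_space UNIV)"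

definition cylinder :: "'x list \<Rightarrow> (nat \<Rightarrow> 'x) set" where
  "cylinder h = {\<omega>. segment \<omega> (length h) = h}"

lemma segment_Suc: "segment \<omega> (Suc n) = segment \<omega> n @ [\<omega> n]"
  by simp

lemma take_segment: "m \<le> n \<Longrightarrow> take m (segment \<omega> n) = segment \<omega> m"
  by (simp add: take_map)

lemma space_paths [simp]: "space paths = UNIV"
  by (simp add: space_PiM)

section \<open>Measurability of events decided by finite prefixes\<close>

lemma measurable_segment: "(\<lambda>\<omega>. segment \<omega> n) \<in> measurable paths (count_space (UNIV :: 'x::countable list set))"
proof -
  have "(\<lambda>\<omega>. map \<omega> xs) \<in> measurable paths (count_space (UNIV :: 'x list set))" for xs
  proof (induction xs)
    case (Cons x xs)
    have [measurable]: "(\<lambda>\<omega>. \<omega> x) \<in> measurable paths (count_space (UNIV :: 'x set))"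
      by (rule measurable_component_singleton) simp
    note Cons[measurable]
    show ?case by simp
  qed simp
  then show ?thesis .
qed

lemma sets_Collect_segment: "{\<omega>. P (segment \<omega> n)} \<in> sets (paths :: (nat \<Rightarrow> 'x::countable) measure)"
  using measurable_sets[OF measurable_segment[of n], of "{h. P h}"] by (simp add: vimage_def)

text \<open>\<open>f n\<close> is the length of the prefix that decides the \<open>n\<close>-th
  event; the acceptance events below are brought into this form.\<close>

lemma sets_Collect_infinite_segment:
  fixes f :: "nat \<Rightarrow> nat"
  shows "{\<omega>. \<exists>\<^sub>\<infinity>n. P n (segment \<omega> (f n))} \<in> sets (paths :: (nat \<Rightarrow> 'x::countable) measure)"
proof -
  have "{\<omega>. \<exists>\<^sub>\<infinity>n. P n (segment \<omega> (f n))} = (\<Inter>m. \<Union>n\<in>{m..}. {\<omega>. P n (segment \<omega> (f n))})"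
    by (auto simp: INFM_nat_le)
  moreover have "{\<omega>. P n (segment \<omega> (f n))} \<in> sets (paths :: (nat \<Rightarrow> 'x) measure)" for n
    by (rule sets_Collect_segment)
  then have "(\<Inter>m. \<Union>n\<in>{m..}. {\<omega>. P n (segment \<omega> (f n))}) \<in> sets (paths :: (nat \<Rightarrow> 'x) measure)"
    using sets.top[of "paths :: (nat \<Rightarrow> 'x) measure"]
    by (intro sets.countable_INT'' sets.countable_UN') (simp_all add: image_subset_iff)
  ultimately show ?thesis by simp
qed

lemma sets_cylinder: "cylinder (h :: 'x::countable list) \<in> sets paths"
  unfolding cylinder_def by (rule sets_Collect_segment)

text \<open>A coordinate event is a countable union of cylinders, as a countable type has only
  countably many lists.\<close>

lemma sets_paths: "sets (paths :: (nat \<Rightarrow> 'x::countable) measure) = sigma_sets UNIV (range cylinder)"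
proof
  interpret S: sigma_algebra UNIV "sigma_sets UNIV (range (cylinder :: 'x list \<Rightarrow> _))"
    by (rule sigma_algebra_sigma_sets) simp
  show "sets (paths :: (nat \<Rightarrow> 'x) measure) \<subseteq> sigma_sets UNIV (range cylinder)"
    unfolding sets_PiM_single space_count_space PiE_UNIV UNIV_def[symmetric]
  proof (rule S.sigma_sets_subset, clarsimp)
    fix i :: nat and A :: "'x set"
    have "{\<omega>. \<omega> i \<in> A} = (\<Union>h\<in>{h. length h = Suc i \<and> h ! i \<in> A}. cylinder h)"
    proof (intro set_eqI iffI)
      fix \<omega> assume "\<omega> \<in> {\<omega>. \<omega> i \<in> A}"
      then show "\<omega> \<in> (\<Union>h\<in>{h. length h = Suc i \<and> h ! i \<in> A}. cylinder h)"
        by (intro UN_I[of "segment \<omega> (Suc i)"]) (auto simp: cylinder_def nth_append)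
    next
      fix \<omega> assume "\<omega> \<in> (\<Union>h\<in>{h. length h = Suc i \<and> h ! i \<in> A}. cylinder h)"
      then obtain h where h: "length h = Suc i" "h ! i \<in> A" "\<omega> \<in> cylinder h" by blast
      then have "segment \<omega> (Suc i) = h" by (simp add: cylinder_def del: upt_Suc)
      then have "h ! i = \<omega> i" by (auto simp: nth_append)
      then show "\<omega> \<in> {\<omega>. \<omega> i \<in> A}" using h by simp
    qed
    also have "\<dots> \<in> sigma_sets UNIV (range cylinder)"
      by (intro S.countable_UN' countableI_type) auto
    finally show "{\<omega>. \<omega> i \<in> A} \<in> sigma_sets UNIV (range cylinder)" .
  qed
  show "sigma_sets UNIV (range cylinder) \<subseteq> sets (paths :: (nat \<Rightarrow> 'x) measure)"
    using sets.sigma_sets_subset[of "range cylinder" "paths :: (nat \<Rightarrow> 'x) measure"] sets_cylinder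
    by auto
qed

lemma cylinder_Int:
  assumes "length h \<le> length h'"
  shows "cylinder h \<inter> cylinder h' = {} \<or> cylinder h \<inter> cylinder h' = cylinder h'"
proof (cases "take (length h) h' = h")
  case True
  have "\<omega> \<in> cylinder h" if "\<omega> \<in> cylinder h'" for \<omega>
    using that take_segment[OF assms, of \<omega>] True by (simp add: cylinder_def)
  then show ?thesis by blast
next
  case False
  have "\<omega> \<notin> cylinder h" if "\<omega> \<in> cylinder h'" for \<omega>
    using that take_segment[OF assms, of \<omega>] False by (simp add: cylinder_def)
  then show ?thesis by blast
qed

lemma paths_measure_eqI:
  fixes M N :: "(nat \<Rightarrow> 'x::countable) measure"
  assumes "sets M = sets paths" "sets N = sets paths" "finite_measure M"
    and eq: "\<And>h. emeasure M (cylinder h) = emeasure N (cylinder h)"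
  shows "M = N"
proof (rule measure_eqI_generator_eq)
  \<comment> \<open>Cylinders of incompatible lists are disjoint, so \<open>{}\<close> is added to
    obtain a generator stable under intersection.\<close>
  let ?E = "insert {} (range cylinder) :: (nat \<Rightarrow> 'x) set set"
  show "Int_stable ?E"
  proof (rule Int_stableI)
    fix a b assume ab: "a \<in> ?E" "b \<in> ?E"
    show "a \<inter> b \<in> ?E"
    proof (cases "a = {} \<or> b = {}")
      case False
      then obtain h h' where h: "a = cylinder h" "b = cylinder h'" using ab by auto
      show ?thesis
        using cylinder_Int[of h h'] cylinder_Int[of h' h] unfolding h
        by (cases "length h \<le> length h'") (auto simp: Int_commute)
    qed auto
  qed
  have *: "sigma_sets UNIV ?E = sigma_sets UNIV (range cylinder)"
    by (rule sigma_sets_eqI) (auto intro: sigma_sets.Empty)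
  show "sets M = sigma_sets UNIV ?E" "sets N = sigma_sets UNIV ?E"
    using assms(1,2) by (simp_all add: sets_paths *)
  show "emeasure M X = emeasure N X" if "X \<in> ?E" for X
    using that eq by auto
  have "cylinder [] = (UNIV :: (nat \<Rightarrow> 'x) set)" by (simp add: cylinder_def)
  then show "range (\<lambda>_::nat. UNIV) \<subseteq> ?E" by (metis image_subset_iff insertI2 rangeI)
  show "emeasure M UNIV \<noteq> \<infinity>"
    using finite_measure.emeasure_finite[OF assms(3)] by simp
qed auto

text \<open>The law of the first \<open>n\<close> elements of a random path, see
  \<open>distr_segment\<close>. Kernels are compared in the discrete calculus and the result is
  lifted to paths afterwards.\<close>

primrec hist :: "('x list \<Rightarrow> 'x pmf) \<Rightarrow> nat \<Rightarrow> 'x list pmf" where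
  "hist K 0 = return_pmf []"
| "hist K (Suc n) = bind_pmf (hist K n) (\<lambda>h. map_pmf (\<lambda>x. h @ [x]) (K h))"

lemma length_hist: "h \<in> set_pmf (hist K n) \<Longrightarrow> length h = n"
  by (induction n arbitrary: h) auto

lemma pmf_hist: "pmf (hist K (length h)) h = (\<Prod>i<length h. pmf (K (take i h)) (h ! i))"
proof (induction h rule: rev_induct)
  case (snoc x h)
  have *: "pmf (map_pmf (\<lambda>x. h' @ [x]) (K h')) (h @ [x]) = indicator {h} h' * pmf (K h) x" for h'
  proof (cases "h' = h")
    case True
    then show ?thesis using pmf_map_inj'[of "\<lambda>x. h @ [x]" "K h" x] by (simp add: inj_def)
  next
    case False
    then have "h @ [x] \<notin> set_pmf (map_pmf (\<lambda>x. h' @ [x]) (K h'))" by auto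
    then show ?thesis using False by (simp add: pmf_eq_0_set_pmf)
  qed
  have "pmf (hist K (length (h @ [x]))) (h @ [x]) = pmf (hist K (length h)) h * pmf (K h) x"
    by (simp add: pmf_bind * measure_pmf_single)
  then show ?case by (simp add: snoc.IH nth_append)
qed simp

lemma distr_segment:
  fixes K :: "'x::countable list \<Rightarrow> 'x pmf"
  shows "distr (path_measure K) (count_space UNIV) (\<lambda>\<omega>. segment \<omega> n) = measure_pmf (hist K n)"
proof (rule measure_eqI_countable[of _ UNIV])
  have m: "(\<lambda>\<omega>. segment \<omega> n) \<in> measurable (path_measure K) (count_space UNIV)"
    using measurable_segment measurable_cong_sets[OF sets_path_measure refl] by blast
  fix h :: "'x list"
  have "emeasure (distr (path_measure K) (count_space UNIV) (\<lambda>\<omega>. segment \<omega> n)) {h} =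
      emeasure (path_measure K) {\<omega>. segment \<omega> n = h}"
    by (simp add: emeasure_distr[OF m] space_path_measure vimage_def)
  also have "\<dots> = ennreal (pmf (hist K n) h)"
  proof (cases "length h = n")
    case True
    then show ?thesis
      using path_measure_cylinder[of K h] pmf_hist[of K h] by (auto simp: prod_ennreal)
  next
    case False
    then have "{\<omega>. segment \<omega> n = h} = {}" "h \<notin> set_pmf (hist K n)"
      using length_hist by auto
    then show ?thesis by (simp add: pmf_eq_0_set_pmf)
  qed
  finally show "emeasure (distr (path_measure K) (count_space UNIV) (\<lambda>\<omega>. segment \<omega> n)) {h} =
      emeasure (measure_pmf (hist K n)) {h}"
    by (simp add: emeasure_pmf_single)
qed auto

lemma emeasure_segment:
  fixes K :: "'x::countable list \<Rightarrow> 'x pmf"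
  shows "emeasure (path_measure K) {\<omega>. P (segment \<omega> n)} = emeasure (measure_pmf (hist K n)) {h. P h}"
proof -
  have m: "(\<lambda>\<omega>. segment \<omega> n) \<in> measurable (path_measure K) (count_space UNIV)"
    using measurable_segment measurable_cong_sets[OF sets_path_measure refl] by blast
  show ?thesis
    unfolding distr_segment[symmetric]
    by (simp add: emeasure_distr[OF m] space_path_measure vimage_def)
qed

text \<open>At each time the invariant can fail only outside the support of \<open>hist K n\<close>,
  and there are countably many times.\<close>

lemma AE_path_measure:
  fixes K :: "'x::countable list \<Rightarrow> 'x pmf"
  assumes "I []" and step: "\<And>h x. I h \<Longrightarrow> x \<in> set_pmf (K h) \<Longrightarrow> I (h @ [x])"
  shows "AE \<omega> in path_measure K. \<forall>n. I (segment \<omega> n)"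
  unfolding AE_all_countable
proof
  fix n
  have I: "I h" if "h \<in> set_pmf (hist K n)" for h
    using that by (induction n arbitrary: h) (use assms in auto)
  have "emeasure (path_measure K) {\<omega>. \<not> I (segment \<omega> n)} = emeasure (hist K n) {h. \<not> I h}"
    by (rule emeasure_segment)
  also have "\<dots> = 0"
    using I by (auto simp: measure_pmf.emeasure_eq_measure measure_pmf_zero_iff)
  finally show "AE \<omega> in path_measure K. I (segment \<omega> n)"
    using sets_Collect_segment[of "\<lambda>h. \<not> I h" n]
    by (intro AE_I[of _ _ "{\<omega>. \<not> I (segment \<omega> n)}"]) (auto simp: sets_path_measure)
qed

text \<open>Cylinders determine a measure on paths, so comparing the laws of finite histories
  suffices.\<close>

lemma distr_path_measure:
  fixes K :: "'y::countable list \<Rightarrow> 'y pmf" and K' :: "'x::countable list \<Rightarrow> 'x pmf"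
  assumes "\<And>n. map_pmf (map \<pi>) (hist K n) = hist K' n"
  shows "distr (path_measure K) paths (\<lambda>\<omega> n. \<pi> (\<omega> n)) = path_measure K'"
    and "(\<lambda>\<omega> n. \<pi> (\<omega> n)) \<in> measurable (path_measure K) paths"
proof -
  have "(\<lambda>\<omega> n. \<pi> (\<omega> n)) \<in> measurable (paths :: (nat \<Rightarrow> 'y) measure) paths"
    by (intro measurable_PiM_single') (auto intro: measurable_compose[OF measurable_component_singleton])
  then show m: "(\<lambda>\<omega> n. \<pi> (\<omega> n)) \<in> measurable (path_measure K) paths"
    using measurable_cong_sets[OF sets_path_measure refl] by blast
  interpret K: prob_space "path_measure K" by (rule prob_space_path_measure)
  show "distr (path_measure K) paths (\<lambda>\<omega> n. \<pi> (\<omega> n)) = path_measure K'"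
  proof (rule paths_measure_eqI)
    show "finite_measure (distr (path_measure K) paths (\<lambda>\<omega> n. \<pi> (\<omega> n)))"
      using K.prob_space_distr[OF m] by (rule prob_space.axioms)
    fix h :: "'x list"
    have "emeasure (distr (path_measure K) paths (\<lambda>\<omega> n. \<pi> (\<omega> n))) (cylinder h) =
        emeasure (path_measure K) {\<omega>. map \<pi> (segment \<omega> (length h)) = h}"
      by (subst emeasure_distr[OF m sets_cylinder])
        (simp add: space_path_measure vimage_def cylinder_def comp_def)
    also have "\<dots> = emeasure (hist K (length h)) {H. map \<pi> H = h}"
      by (rule emeasure_segment)
    also have "\<dots> = emeasure (map_pmf (map \<pi>) (hist K (length h))) {h}"
      by (simp add: vimage_def)
    also have "\<dots> = emeasure (hist K' (length h)) {H. H = h}"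
      by (simp add: assms)
    also have "\<dots> = emeasure (path_measure K') (cylinder h)"
      unfolding cylinder_def by (rule emeasure_segment[symmetric])
    finally show "emeasure (distr (path_measure K) paths (\<lambda>\<omega> n. \<pi> (\<omega> n))) (cylinder h) =
        emeasure (path_measure K') (cylinder h)" .
  qed (simp_all add: sets_path_measure)
qed

text \<open>Disintegration: draw the image first, then a point from the conditional law on its
  fibre.\<close>

lemma bind_cond_pmf_fibres: "bind_pmf (map_pmf g p) (\<lambda>x. cond_pmf p {y. g y = x}) = p"
proof (rule bind_cond_pmf_cancel)
  fix x y assume "g y = x"
  then have "{x. g y = x} = {x}" by auto
  then show "measure_pmf.prob p {y. g y = x} = measure_pmf.prob (map_pmf g p) {x. g y = x}"
    by (simp add: vimage_def)
qed auto

text \<open>The visible part of a process is generated by the kernel that averages the projected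
  step over the conditional law of the full history given the visible one. The condition is
  restricted to visible histories of positive probability, where conditioning makes sense.\<close>

lemma map_hist:
  assumes "\<And>n h. h \<in> map \<pi> ` set_pmf (hist K n) \<Longrightarrow>
    K' h = bind_pmf (cond_pmf (hist K n) {H. map \<pi> H = h}) (\<lambda>H. map_pmf \<pi> (K H))"
  shows "map_pmf (map \<pi>) (hist K n) = hist K' n"
proof (induction n)
  case (Suc n)
  let ?c = "\<lambda>h. cond_pmf (hist K n) {H. map \<pi> H = h}"
  have "hist K' (Suc n) = bind_pmf (map_pmf (map \<pi>) (hist K n)) (\<lambda>h. map_pmf (\<lambda>x. h @ [x]) (K' h))"
    by (simp add: Suc)
  also have "\<dots> = bind_pmf (map_pmf (map \<pi>) (hist K n)) (\<lambda>h. bind_pmf (?c h)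
      (\<lambda>H. map_pmf (\<lambda>x. map \<pi> H @ [x]) (map_pmf \<pi> (K H))))"
  proof (rule bind_pmf_cong[OF refl])
    fix h assume h: "h \<in> set_pmf (map_pmf (map \<pi>) (hist K n))"
    have "map_pmf (\<lambda>x. h @ [x]) (K' h) =
        bind_pmf (?c h) (\<lambda>H. map_pmf (\<lambda>x. h @ [x]) (map_pmf \<pi> (K H)))"
      using assms[of h n] h by (simp add: map_bind_pmf)
    also have "\<dots> = bind_pmf (?c h) (\<lambda>H. map_pmf (\<lambda>x. map \<pi> H @ [x]) (map_pmf \<pi> (K H)))"
    proof (rule bind_pmf_cong[OF refl])
      fix H assume "H \<in> set_pmf (?c h)"
      moreover have "set_pmf (hist K n) \<inter> {H. map \<pi> H = h} \<noteq> {}" using h by auto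
      ultimately have "map \<pi> H = h" by (simp add: set_cond_pmf)
      then show "map_pmf (\<lambda>x. h @ [x]) (map_pmf \<pi> (K H)) =
          map_pmf (\<lambda>x. map \<pi> H @ [x]) (map_pmf \<pi> (K H))" by simp
    qed
    finally show "map_pmf (\<lambda>x. h @ [x]) (K' h) =
        bind_pmf (?c h) (\<lambda>H. map_pmf (\<lambda>x. map \<pi> H @ [x]) (map_pmf \<pi> (K H)))" .
  qed
  also have "\<dots> = bind_pmf (hist K n) (\<lambda>H. map_pmf (\<lambda>x. map \<pi> H @ [x]) (map_pmf \<pi> (K H)))"
    unfolding bind_assoc_pmf[symmetric] bind_cond_pmf_fibres ..
  also have "\<dots> = map_pmf (map \<pi>) (hist K (Suc n))"
    by (simp add: map_bind_pmf map_pmf_comp)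
  finally show ?case by simp
qed simp

text \<open>The events approximable by finite prefixes contain the cylinders and are closed under
  complements and countable unions; a union is cut off at a finite stage by continuity from
  below.\<close>

lemma approx_by_segment:
  fixes K :: "'x::countable list \<Rightarrow> 'x pmf"
  assumes "A \<in> sets paths" "0 < e"
  shows "\<exists>n C. measure (path_measure K) (sym_diff A {\<omega>. segment \<omega> n \<in> C}) < e"
proof -
  interpret prob_space "path_measure K" by (rule prob_space_path_measure)
  let ?cl = "\<lambda>n C. {\<omega> :: nat \<Rightarrow> 'x. segment \<omega> n \<in> C}"
  define approx where "approx A \<longleftrightarrow> A \<in> events \<and> (\<forall>e>0. \<exists>n C. prob (sym_diff A (?cl n C)) < e)" for A
  have cl: "?cl n C \<in> events" for n C
    using sets_Collect_segment[of "\<lambda>h. h \<in> C" n] by (simp add: sets_path_measure)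
  have Un: "approx (A \<union> B)" if A: "approx A" and B: "approx B" for A B
    unfolding approx_def
  proof (intro conjI allI impI)
    show AB: "A \<union> B \<in> events" using A B by (auto simp: approx_def)
    fix e :: real assume "e > 0"
    then obtain n C m D where C: "prob (sym_diff A (?cl n C)) < e / 2"
      and D: "prob (sym_diff B (?cl m D)) < e / 2"
      using A B unfolding approx_def by (meson half_gt_zero)
    define k where "k = max n m"
    let ?X = "{h. take n h \<in> C \<or> take m h \<in> D}"
    have k: "?cl k ?X = ?cl n C \<union> ?cl m D"
      by (auto simp: k_def take_segment simp del: take_map)
    have "prob (sym_diff (A \<union> B) (?cl k ?X)) \<le> prob (sym_diff A (?cl n C) \<union> sym_diff B (?cl m D))"
      unfolding k using A B cl by (intro finite_measure_mono) (auto simp: approx_def)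
    also have "\<dots> \<le> prob (sym_diff A (?cl n C)) + prob (sym_diff B (?cl m D))"
      using A B cl by (intro measure_Un_le) (auto simp: approx_def)
    also have "\<dots> < e" using C D by simp
    finally show "\<exists>n C. prob (sym_diff (A \<union> B) (?cl n C)) < e" by blast
  qed
  have compl: "approx (UNIV - A)" if A: "approx A" for A
    unfolding approx_def
  proof (intro conjI allI impI)
    show "UNIV - A \<in> events"
      using A sets.compl_sets[of A "path_measure K"] by (simp add: approx_def space_path_measure)
    fix e :: real assume "e > 0"
    then obtain n C where "prob (sym_diff A (?cl n C)) < e" using A unfolding approx_def by blast
    moreover have "sym_diff (UNIV - A) (?cl n (- C)) = sym_diff A (?cl n C)" by auto
    ultimately show "\<exists>n C. prob (sym_diff (UNIV - A) (?cl n C)) < e" by metis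
  qed
  have empty: "approx {}"
    unfolding approx_def by (auto intro!: exI[of _ 0] exI[of _ "{}"])
  have UN: "approx (\<Union>i. A i)" if A: "\<And>i::nat. approx (A i)" for A
    unfolding approx_def
  proof (intro conjI allI impI)
    have ev: "A i \<in> events" for i using A by (simp add: approx_def)
    then show UA: "(\<Union>i. A i) \<in> events" by auto
    fix e :: real assume e: "e > 0"
    define F where "F n = (\<Union>i<n. A i)" for n
    have Fa: "approx (F n)" for n
      by (induction n) (use empty Un A in \<open>auto simp: F_def lessThan_Suc\<close>)
    then have F: "F n \<in> events" for n by (simp add: approx_def)
    have "(\<lambda>n. prob (F n)) \<longlonglongrightarrow> prob (\<Union>n. F n)"
      using F by (intro finite_Lim_measure_incseq) (auto simp: F_def incseq_def, force)
    moreover have UF: "(\<Union>n. F n) = (\<Union>i. A i)" by (auto simp: F_def)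
    ultimately have "\<forall>\<^sub>F n in sequentially. prob (F n) > prob (\<Union>i. A i) - e / 2"
      using e by (intro order_tendstoD(1)) auto
    then obtain n where n: "prob (F n) > prob (\<Union>i. A i) - e / 2"
      by (auto simp: eventually_sequentially)
    obtain m C where C: "prob (sym_diff (F n) (?cl m C)) < e / 2"
      using Fa[of n] e unfolding approx_def by (meson half_gt_zero)
    have sub: "F n \<subseteq> (\<Union>i. A i)" by (auto simp: F_def)
    have "prob (sym_diff (\<Union>i. A i) (?cl m C)) \<le> prob (((\<Union>i. A i) - F n) \<union> sym_diff (F n) (?cl m C))"
      using UA F cl sub by (intro finite_measure_mono) auto
    also have "\<dots> \<le> prob ((\<Union>i. A i) - F n) + prob (sym_diff (F n) (?cl m C))"
      using UA F cl by (intro measure_Un_le) auto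
    also have "prob ((\<Union>i. A i) - F n) = prob (\<Union>i. A i) - prob (F n)"
      using UA F sub by (intro finite_measure_Diff)
    finally have "prob (sym_diff (\<Union>i. A i) (?cl m C)) < e" using n C by linarith
    then show "\<exists>n C. prob (sym_diff (\<Union>i. A i) (?cl n C)) < e" by blast
  qed
  have "A \<in> sigma_sets UNIV (range cylinder)" using assms(1) by (simp add: sets_paths)
  then have "approx A"
  proof (induction rule: sigma_sets.induct)
    case (Basic A)
    then obtain h where "A = cylinder h" by auto
    then have A: "A = ?cl (length h) {h}" by (simp add: cylinder_def)
    have *: "prob (sym_diff A (?cl (length h) {h})) = 0" unfolding A by simp
    show ?case
      unfolding approx_def
    proof (intro conjI allI impI)
      show "A \<in> events" unfolding A by (rule cl)
      fix e :: real assume "e > 0"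
      then show "\<exists>n C. prob (sym_diff A (?cl n C)) < e"
        using * by (intro exI[of _ "length h"] exI[of _ "{h}"]) simp
    qed
  next
    case Empty
    show ?case by (rule empty)
  next
    case (Compl A)
    show ?case by (rule compl[OF Compl.IH])
  next
    case (Union A)
    show ?case by (rule UN[OF Union.IH])
  qed
  then show ?thesis using assms(2) by (simp add: approx_def)
qed

section \<open>Product strategies and strategies of the MDP\<close>

lemma state_at_0 [simp]: "state_at x0 \<omega> 0 = x0" and state_at_Suc [simp]: "state_at x0 \<omega> (Suc n) = snd (\<omega> n)"
  by (simp_all add: state_at_def)

lemma state_at_cong: "(\<And>i. i < n \<Longrightarrow> \<omega> i = \<omega>' i) \<Longrightarrow> state_at x0 \<omega> n = state_at x0 \<omega>' n"
  by (cases n) simp_all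

lemma state_at_append: "i \<le> length h \<Longrightarrow> state_at x0 ((!) (h @ h')) i = state_at x0 ((!) h) i"
  by (rule state_at_cong) (simp add: nth_append)

lemma state_at_segment: "i \<le> n \<Longrightarrow> state_at x0 ((!) (segment \<omega> n)) i = state_at x0 \<omega> i"
  by (rule state_at_cong) simp

lemma last_state_Nil [simp]: "last_state x0 [] = x0"
  by (simp add: last_state_def)

lemma last_state_snoc [simp]: "last_state x0 (h @ [x]) = snd x"
  by (simp add: last_state_def)

lemma last_state_segment: "last_state x0 (segment \<omega> n) = state_at x0 \<omega> n"
  by (simp add: last_state_def state_at_segment)

lemma labeled_run_cong:
  "(\<And>i. i \<le> n \<Longrightarrow> \<omega> i = \<omega>' i) \<Longrightarrow> labeled_run M \<omega> n = labeled_run M \<omega>' n"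
  using state_at_cong[of n \<omega> \<omega>' "mdp_init M"] by (simp add: labeled_run_def)

lemma labeled_run_segment:
  "i < n \<Longrightarrow> labeled_run M ((!) (segment \<omega> n)) i = labeled_run M \<omega> i"
  by (rule labeled_run_cong) simp

lemma finite_run_Nil [simp]: "finite_run M []"
  by (simp add: finite_run_def)

lemma finite_run_snoc: "finite_run M (h @ [(a, s')]) \<longleftrightarrow>
    finite_run M h \<and> a \<in> avail M (last_state (mdp_init M) h) \<and>
    s' \<in> set_pmf (kernel M (last_state (mdp_init M) h) a)"
  by (auto simp: finite_run_def last_state_def less_Suc_eq state_at_append nth_append Let_def
      pmf_positive_iff)

lemma finite_product_run_Nil [simp]: "finite_product_run M C []"
  by (simp add: finite_product_run_def)

lemma finite_product_run_snoc: "finite_product_run M C (h @ [(a, s', q')]) \<longleftrightarrow>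
    finite_product_run M C h \<and> a \<in> avail M (fst (last_state (product_init M C) h)) \<and>
    s' \<in> set_pmf (kernel M (fst (last_state (product_init M C) h)) a) \<and>
    (snd (last_state (product_init M C) h), label M (fst (last_state (product_init M C) h)) a s', q')
      \<in> transitions C"
  by (auto simp: finite_product_run_def last_state_def less_Suc_eq state_at_append nth_append Let_def
      pmf_positive_iff case_prod_beta)

lemma product_strategies_iff: "fg \<in> product_strategies M C \<longleftrightarrow>
    (\<forall>h. finite_product_run M C h \<longrightarrow>
      set_pmf (fst fg h) \<subseteq> avail M (fst (last_state (product_init M C) h)) \<and>
      (\<forall>a\<in>avail M (fst (last_state (product_init M C) h)).
        \<forall>s'\<in>set_pmf (kernel M (fst (last_state (product_init M C) h)) a).
          set_pmf (snd fg h a s') \<subseteq> {q'. (snd (last_state (product_init M C) h),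
            label M (fst (last_state (product_init M C) h)) a s', q') \<in> transitions C}))"
  by (simp add: product_strategies_def case_prod_beta)

section \<open>Projection of product runs to the MDP\<close>

definition mdp_part :: "'act \<times> 's \<times> 'q \<Rightarrow> 'act \<times> 's" where
  "mdp_part x = (fst x, fst (snd x))"

lemma last_state_mdp_part:
  "last_state (mdp_init M) (map mdp_part H) = fst (last_state (product_init M C) H)"
  by (cases H rule: rev_cases) (simp_all add: product_init_def mdp_part_def)

lemma finite_run_mdp_part: "finite_product_run M C H \<Longrightarrow> finite_run M (map mdp_part H)"
proof (induction H rule: rev_induct)
  case (snoc x H)
  then show ?case
    by (cases x) (simp add: finite_product_run_snoc finite_run_snoc last_state_mdp_part[of M H C]
        mdp_part_def[of "(_, _)"])
qed simp

lemma last_state_in_mdp_states: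
  assumes "mdp_over \<Sigma> M"
  shows "finite_run M h \<Longrightarrow> last_state (mdp_init M) h \<in> mdp_states M"
proof (induction h rule: rev_induct)
  case Nil
  then show ?case using assms by (simp add: mdp_over_def)
next
  case (snoc x h)
  obtain a s' where x: "x = (a, s')" by force
  have "set_pmf (kernel M (last_state (mdp_init M) h) a) \<subseteq> mdp_states M"
    using snoc assms unfolding x finite_run_snoc mdp_over_def by blast
  then show ?case using snoc.prems unfolding x finite_run_snoc by auto
qed

lemma label_in_alphabet:
  assumes M: "mdp_over \<Sigma> M" and "finite_run M h" "a \<in> avail M (last_state (mdp_init M) h)"
    "s' \<in> set_pmf (kernel M (last_state (mdp_init M) h) a)"
  shows "label M (last_state (mdp_init M) h) a s' \<in> \<Sigma>"
proof -
  have "last_state (mdp_init M) h \<in> mdp_states M" by (rule last_state_in_mdp_states[OF assms(1,2)])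
  moreover have "s' \<in> mdp_states M"
    using last_state_in_mdp_states[OF M, of "h @ [(a, s')]"] assms by (simp add: finite_run_snoc)
  ultimately show ?thesis using assms unfolding mdp_over_def by blast
qed

lemma AE_finite_run:
  assumes "f \<in> strategies M"
  shows "AE \<omega> in path_measure (step_pmf M f). \<forall>n. finite_run M (segment \<omega> n)"
proof (rule AE_path_measure)
  fix h x assume "finite_run M h" "x \<in> set_pmf (step_pmf M f h)"
  then show "finite_run M (h @ [x])"
    using assms by (cases x) (auto simp: step_pmf_def finite_run_snoc strategies_def)
qed simp

lemma finite_product_run_step:
  assumes "fg \<in> product_strategies M C" "finite_product_run M C h"
    "x \<in> set_pmf (product_step_pmf M C fg h)"
  shows "finite_product_run M C (h @ [x])"
proof -
  obtain a s' q' where x: "x = (a, s', q')" by (metis prod.collapse)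
  have "a \<in> set_pmf (fst fg h)" "s' \<in> set_pmf (kernel M (fst (last_state (product_init M C) h)) a)"
    "q' \<in> set_pmf (snd fg h a s')"
    using assms(3) by (auto simp: x product_step_pmf_def)
  then show ?thesis
    using assms(1,2) unfolding x finite_product_run_snoc product_strategies_iff by blast
qed

lemma map_mdp_part_product_step:
  "map_pmf mdp_part (product_step_pmf M C fg H) =
    bind_pmf (fst fg H) (\<lambda>a. bind_pmf (kernel M (last_state (mdp_init M) (map mdp_part H)) a)
      (\<lambda>s'. return_pmf (a, s')))"
  by (simp add: product_step_pmf_def map_bind_pmf mdp_part_def[of "(_, _)"]
      last_state_mdp_part[of M H C])

lemma built_run_accepting_iff:
  "built_run_accepting M C \<omega> \<longleftrightarrow> accepting C (labeled_run M (\<lambda>n. mdp_part (\<omega> n)))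
    (\<lambda>n. snd (state_at (product_init M C) \<omega> n))"
  by (simp add: built_run_accepting_def mdp_part_def)

lemma product_transition:
  assumes "finite_product_run M C (segment \<omega> (Suc n))"
  shows "(snd (state_at (product_init M C) \<omega> n), labeled_run M (\<lambda>n. mdp_part (\<omega> n)) n,
    snd (state_at (product_init M C) \<omega> (Suc n))) \<in> transitions C"
proof -
  obtain a s' q' where x: "\<omega> n = (a, s', q')" by (metis prod.collapse)
  have "state_at (mdp_init M) (\<lambda>n. mdp_part (\<omega> n)) n = fst (state_at (product_init M C) \<omega> n)"
    by (cases n) (simp_all add: product_init_def mdp_part_def)
  then show ?thesis
    using assms finite_product_run_snoc[of M C "segment \<omega> n" a s' q']
    by (simp add: labeled_run_def x last_state_segment mdp_part_def[of "(_, _)"])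
qed

text \<open>
  A product strategy induces the strategy that draws its action as the product strategy would,
  conditioned on the part of the history that belongs to the MDP.
\<close>

lemma PSyn_complete_le_PSem:
  fixes M :: "('s::countable, 'act::countable, 'a) mdp" and C :: "('a, 'q::countable) nba"
  assumes C: "buchi C" "initial C = {q0}" and M: "mdp_over (alphabet C) M"
    and meas: "{\<omega>. labeled_run M \<omega> \<in> language C} \<in> sets paths"
  shows "PSyn M (complete C) \<le> PSem M C"
  unfolding PSyn_def
proof (rule SUP_least)
  let ?D = "complete C" and ?i = "mdp_init M"
  fix fg assume fg: "fg \<in> product_strategies M ?D"
  define K where "K = product_step_pmf M ?D fg"
  have run: "finite_product_run M ?D H" if "H \<in> set_pmf (hist K n)" for H n
    using that
  proof (induction n arbitrary: H)
    case (Suc n)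
    then show ?case using finite_product_run_step[OF fg] by (auto simp: K_def)
  qed simp
  \<comment> \<open>Finite runs that are not the projection of a possible product history still need
    some available action; any will do.\<close>
  define f where "f h = (if h \<in> map mdp_part ` set_pmf (hist K (length h))
      then bind_pmf (cond_pmf (hist K (length h)) {H. map mdp_part H = h}) (fst fg)
      else return_pmf (SOME a. a \<in> avail M (last_state ?i h)))" for h
  have set_cond: "set_pmf (cond_pmf (hist K n) {H. map mdp_part H = h}) =
      set_pmf (hist K n) \<inter> {H. map mdp_part H = h}"
    if "h \<in> map mdp_part ` set_pmf (hist K n)" for h n
    using that by (intro set_cond_pmf) auto
  have f: "f \<in> strategies M"
    unfolding strategies_def
  proof (clarify)
    fix h a assume h: "finite_run M h" and a: "a \<in> set_pmf (f h)"
    show "a \<in> avail M (last_state ?i h)"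
    proof (cases "h \<in> map mdp_part ` set_pmf (hist K (length h))")
      case True
      then obtain H where H: "H \<in> set_pmf (hist K (length h))" "map mdp_part H = h"
        "a \<in> set_pmf (fst fg H)"
        using a set_cond[OF True] by (auto simp: f_def)
      show ?thesis
        using fg run[OF H(1)] H(3)
        unfolding product_strategies_iff H(2)[symmetric] last_state_mdp_part[of M H ?D] by blast
    next
      case False
      have "avail M (last_state ?i h) \<noteq> {}"
        using M last_state_in_mdp_states[OF M h] by (auto simp: mdp_over_def)
      then show ?thesis using a False by (auto simp: f_def some_in_eq)
    qed
  qed
  have "map_pmf (map mdp_part) (hist K n) = hist (step_pmf M f) n" for n
  proof (rule map_hist)
    fix n h assume h: "h \<in> map mdp_part ` set_pmf (hist K n)"
    then have n: "length h = n" using length_hist by auto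
    let ?c = "cond_pmf (hist K n) {H. map mdp_part H = h}"
    have "step_pmf M f h = bind_pmf ?c (\<lambda>H. bind_pmf (fst fg H)
        (\<lambda>a. bind_pmf (kernel M (last_state ?i h) a) (\<lambda>s'. return_pmf (a, s'))))"
      using h by (simp add: step_pmf_def f_def n bind_assoc_pmf)
    also have "\<dots> = bind_pmf ?c (\<lambda>H. map_pmf mdp_part (K H))"
      unfolding K_def map_mdp_part_product_step
      by (rule bind_pmf_cong[OF refl]) (use set_cond[OF h] in \<open>auto simp: K_def\<close>)
    finally show "step_pmf M f h = bind_pmf ?c (\<lambda>H. map_pmf mdp_part (K H))" .
  qed
  note distr = distr_path_measure[where \<pi> = mdp_part, OF this]
  have "AE \<omega> in path_measure K. \<forall>n. finite_product_run M ?D (segment \<omega> n)"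
    by (rule AE_path_measure) (use finite_product_run_step[OF fg] in \<open>auto simp: K_def\<close>)
  \<comment> \<open>The implication is only almost sure: off the legal product runs a sequence can
    be accepting without following the transitions.\<close>
  then have "AE \<omega> in path_measure K. \<omega> \<in> {\<omega>. built_run_accepting M ?D \<omega>} \<longrightarrow>
      \<omega> \<in> {\<omega>. labeled_run M (\<lambda>n. mdp_part (\<omega> n)) \<in> language C}"
  proof (rule AE_mp, intro AE_I2 impI)
    fix \<omega> assume r: "\<forall>n. finite_product_run M ?D (segment \<omega> n)"
      and acc: "\<omega> \<in> {\<omega>. built_run_accepting M ?D \<omega>}"
    have "snd (state_at (product_init M ?D) \<omega> 0) \<in> initial ?D"
      using C(2) by (simp add: product_init_def initial_state_def complete_def)
    moreover have "accepting ?D (labeled_run M (\<lambda>n. mdp_part (\<omega> n)))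
        (\<lambda>n. snd (state_at (product_init M ?D) \<omega> n))"
      using acc by (simp add: built_run_accepting_iff)
    ultimately have "labeled_run M (\<lambda>n. mdp_part (\<omega> n)) \<in> language C"
      by (intro language_if_complete_accepting[OF C(1),
            where r = "\<lambda>n. snd (state_at (product_init M ?D) \<omega> n)"] product_transition)
        (use r in blast)+
    then show "\<omega> \<in> {\<omega>. labeled_run M (\<lambda>n. mdp_part (\<omega> n)) \<in> language C}" by simp
  qed
  moreover have pre: "{\<omega>. labeled_run M (\<lambda>n. mdp_part (\<omega> n)) \<in> language C} \<in> sets (path_measure K)"
    using measurable_sets[OF distr(2) meas] by (simp add: vimage_def space_path_measure)
  ultimately have "emeasure (path_measure K) {\<omega>. built_run_accepting M ?D \<omega>} \<le>
      emeasure (path_measure K) {\<omega>. labeled_run M (\<lambda>n. mdp_part (\<omega> n)) \<in> language C}"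
    by (rule emeasure_mono_AE)
  also have "\<dots> = emeasure (path_measure (step_pmf M f)) {\<omega>. labeled_run M \<omega> \<in> language C}"
    unfolding distr(1)[symmetric]
    by (subst emeasure_distr[OF distr(2) meas]) (simp add: vimage_def space_path_measure)
  also have "\<dots> \<le> PSem M C"
    unfolding PSem_def using f by (rule SUP_upper)
  finally show "emeasure (path_measure (product_step_pmf M ?D fg)) {\<omega>. built_run_accepting M ?D \<omega>}
      \<le> PSem M C" by (simp add: K_def)
qed

text \<open>
  An online resolution \<^term>\<open>nxt\<close> of the nondeterminism only depends on the history of the MDP.
  The product strategy built from it leaves \<^term>\<open>nxt\<close> only on histories of probability zero.
\<close>

lemma PSyn_ge_online:
  fixes M :: "('s::countable, 'act::countable, 'a) mdp" and D :: "('a, 'q::countable) nba"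
    and nxt :: "('act \<times> 's) list \<Rightarrow> 'q"
  assumes D: "buchi D" "initial D = {q0}"
    and total: "\<And>q \<sigma>. q \<in> states D \<Longrightarrow> \<sigma> \<in> alphabet D \<Longrightarrow> \<exists>q'. (q, \<sigma>, q') \<in> transitions D"
    and M: "mdp_over (alphabet D) M" and f: "f \<in> strategies M"
    and nxt_Nil: "nxt [] = q0"
    and nxt: "\<And>h a s'. finite_run M (h @ [(a, s')]) \<Longrightarrow>
      (nxt h, label M (last_state (mdp_init M) h) a s', nxt (h @ [(a, s')])) \<in> transitions D"
  shows "emeasure (path_measure (step_pmf M f))
      {\<omega>. accepting D (labeled_run M \<omega>) (\<lambda>n. nxt (segment \<omega> n))} \<le> PSyn M D"
    (is "emeasure _ ?A \<le> _")
proof -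
  let ?p = "product_init M D"
  define legal where "legal H a s' =
    {q'. (snd (last_state ?p H), label M (fst (last_state ?p H)) a s', q') \<in> transitions D}"
    for H :: "('act \<times> 's \<times> 'q) list" and a s'
  \<comment> \<open>A product strategy must be legal on every finite product run, also where the
    automaton component has departed from \<open>nxt\<close>; totality of \<open>D\<close> provides
    the fallback.\<close>
  define g where "g H a s' = (let q = nxt (map mdp_part H @ [(a, s')]) in
    return_pmf (if q \<in> legal H a s' then q else (SOME q'. q' \<in> legal H a s')))" for H a s'
  define fg :: "('s, 'act, 'q) product_strategy" where "fg = (\<lambda>H. f (map mdp_part H), g)"
  define K where "K = product_step_pmf M D fg"
  have states: "snd (last_state ?p H) \<in> states D" if "finite_product_run M D H" for H
    using that
  proof (cases H rule: rev_cases)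
    case Nil
    then show ?thesis using D by (simp add: product_init_def initial_state_def buchi_def)
  next
    case (snoc H' x)
    then show ?thesis using that D(1) by (cases x) (auto simp: finite_product_run_snoc buchi_def)
  qed
  have fg: "fg \<in> product_strategies M D"
    unfolding product_strategies_iff fg_def fst_conv snd_conv
  proof (intro allI impI conjI ballI)
    fix H assume H: "finite_product_run M D H"
    let ?s = "fst (last_state ?p H)"
    have hr: "finite_run M (map mdp_part H)" by (rule finite_run_mdp_part[OF H])
    show "set_pmf (f (map mdp_part H)) \<subseteq> avail M ?s"
      using f hr unfolding strategies_def last_state_mdp_part[of M H D, symmetric] by blast
    fix a s' assume "a \<in> avail M ?s" "s' \<in> set_pmf (kernel M ?s a)"
    then have "label M ?s a s' \<in> alphabet D"
      using label_in_alphabet[OF M hr] by (simp add: last_state_mdp_part[of M H D])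
    then have "\<exists>q'. q' \<in> legal H a s'" using total states[OF H] by (simp add: legal_def)
    then have "(SOME q'. q' \<in> legal H a s') \<in> legal H a s'" by (rule someI_ex)
    then show "set_pmf (g H a s') \<subseteq> {q'. (snd (last_state ?p H), label M ?s a s', q') \<in> transitions D}"
      unfolding legal_def[symmetric] by (simp add: g_def Let_def)
  qed
  have "map_pmf (map mdp_part) (hist K n) = hist (step_pmf M f) n" for n
  proof (rule map_hist)
    fix n h assume h: "h \<in> map mdp_part ` set_pmf (hist K n)"
    let ?c = "cond_pmf (hist K n) {H. map mdp_part H = h}"
    \<comment> \<open>The MDP part of a product step depends only on the MDP part of the history, so
      the conditional average is over a constant.\<close>
    have "bind_pmf ?c (\<lambda>H. map_pmf mdp_part (K H)) = bind_pmf ?c (\<lambda>H. step_pmf M f h)"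
    proof (rule bind_pmf_cong[OF refl])
      fix H assume "H \<in> set_pmf ?c"
      moreover have "set_pmf (hist K n) \<inter> {H. map mdp_part H = h} \<noteq> {}" using h by auto
      ultimately have "map mdp_part H = h" by (simp add: set_cond_pmf)
      then show "map_pmf mdp_part (K H) = step_pmf M f h"
        unfolding K_def map_mdp_part_product_step by (simp add: fg_def step_pmf_def)
    qed
    then show "step_pmf M f h = bind_pmf ?c (\<lambda>H. map_pmf mdp_part (K H))"
      by (simp add: bind_pmf_const)
  qed
  note distr = distr_path_measure[where \<pi> = mdp_part, OF this]
  define follows where "follows H \<longleftrightarrow> finite_product_run M D H \<and>
    snd (last_state ?p H) = nxt (map mdp_part H)" for H
  have "AE \<omega> in path_measure K. \<forall>n. follows (segment \<omega> n)"
  proof (rule AE_path_measure)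
    show "follows []" using D(2) by (simp add: follows_def product_init_def initial_state_def nxt_Nil)
    fix H x assume H: "follows H" and x: "x \<in> set_pmf (K H)"
    obtain a s' q' where [simp]: "x = (a, s', q')" by (metis prod.collapse)
    have run: "finite_product_run M D (H @ [x])"
      using finite_product_run_step[OF fg] H x by (auto simp: follows_def K_def)
    then have "finite_run M (map mdp_part H @ [(a, s')])"
      using finite_run_mdp_part[OF run] by (simp add: mdp_part_def[of "(_, _)"])
    from nxt[OF this] have "nxt (map mdp_part H @ [(a, s')]) \<in> legal H a s'"
      using H by (simp add: legal_def follows_def last_state_mdp_part[of M H D])
    moreover have "q' \<in> set_pmf (g H a s')"
      using x by (auto simp: K_def product_step_pmf_def fg_def)
    ultimately have "q' = nxt (map mdp_part H @ [(a, s')])" by (simp add: g_def Let_def)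
    then show "follows (H @ [x])"
      using run by (simp add: follows_def mdp_part_def[of "(_, _)"])
  qed
  then have AE: "AE \<omega> in path_measure K. \<omega> \<in> {\<omega>. (\<lambda>n. mdp_part (\<omega> n)) \<in> ?A} \<longrightarrow>
      \<omega> \<in> {\<omega>. built_run_accepting M D \<omega>}"
  proof (rule AE_mp, intro AE_I2 impI)
    fix \<omega> assume r: "\<forall>n. follows (segment \<omega> n)" and A: "\<omega> \<in> {\<omega>. (\<lambda>n. mdp_part (\<omega> n)) \<in> ?A}"
    have "snd (state_at ?p \<omega> n) = nxt (segment (\<lambda>n. mdp_part (\<omega> n)) n)" for n
      using r[rule_format, of n] by (simp add: follows_def last_state_segment comp_def)
    then show "\<omega> \<in> {\<omega>. built_run_accepting M D \<omega>}"
      using A by (simp add: built_run_accepting_iff)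
  qed
  have "{\<omega>. accepting D (labeled_run M \<omega>) (\<lambda>n. nxt (segment \<omega> n))} =
      {\<omega>. \<exists>\<^sub>\<infinity>n. (nxt (take n (segment \<omega> (Suc n))),
        labeled_run M ((!) (segment \<omega> (Suc n))) n, nxt (segment \<omega> (Suc n))) \<in> acc_transitions D}"
    unfolding accepting_def by (simp only: take_segment[OF le_SucI[OF order_refl]]
        labeled_run_segment[OF lessI])
  also have "\<dots> \<in> sets paths"
    by (rule sets_Collect_infinite_segment[where f = Suc and P = "\<lambda>n h. (nxt (take n h),
          labeled_run M ((!) h) n, nxt h) \<in> acc_transitions D"])
  finally have A: "?A \<in> sets paths" .
  have lab: "labeled_run M (\<lambda>n. mdp_part (\<omega> n)) n =
      labeled_run M (\<lambda>n. mdp_part (segment \<omega> (Suc n') ! n)) n" if "n \<le> n'" for \<omega> n n'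
    by (rule labeled_run_cong) (use that in \<open>simp del: upt_Suc\<close>)
  have "{\<omega>. built_run_accepting M D \<omega>} = {\<omega>. \<exists>\<^sub>\<infinity>n.
      (snd (state_at ?p ((!) (segment \<omega> (Suc n))) n), labeled_run M (\<lambda>i. mdp_part (segment \<omega> (Suc n) ! i)) n,
        snd (state_at ?p ((!) (segment \<omega> (Suc n))) (Suc n))) \<in> acc_transitions D}"
    unfolding built_run_accepting_iff accepting_def
    by (simp only: state_at_segment[OF le_SucI[OF order_refl]] state_at_segment[OF order_refl]
        lab[OF order_refl, symmetric])
  also have "\<dots> \<in> sets paths"
    by (rule sets_Collect_infinite_segment[where f = Suc and P = "\<lambda>n h. (snd (state_at ?p ((!) h) n),
          labeled_run M (\<lambda>i. mdp_part (h ! i)) n, snd (state_at ?p ((!) h) (Suc n))) \<in> acc_transitions D"])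
  finally have built: "{\<omega>. built_run_accepting M D \<omega>} \<in> sets (path_measure K)"
    by (simp add: sets_path_measure)
  have "emeasure (path_measure (step_pmf M f)) ?A =
      emeasure (path_measure K) {\<omega>. (\<lambda>n. mdp_part (\<omega> n)) \<in> ?A}"
    unfolding distr(1)[symmetric]
    by (subst emeasure_distr[OF distr(2) A]) (simp add: vimage_def space_path_measure)
  also have "\<dots> \<le> emeasure (path_measure K) {\<omega>. built_run_accepting M D \<omega>}"
    by (rule emeasure_mono_AE[OF AE built])
  also have "\<dots> \<le> PSyn M D"
    unfolding PSyn_def K_def using fg by (rule SUP_upper)
  finally show ?thesis .
qed

section \<open>Goodness for MDPs\<close>

lemma buchi_complete: "buchi C \<Longrightarrow> buchi (complete C)"
  unfolding buchi_def complete_def by auto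

lemma complete_total:
  assumes "q \<in> states (complete C)" "\<sigma> \<in> alphabet (complete C)"
  shows "\<exists>q'. (q, \<sigma>, q') \<in> transitions (complete C)"
proof (cases q)
  case None
  then show ?thesis using assms(2) by (auto simp: complete_def)
next
  case (Some p)
  then have "p \<in> states C" "\<sigma> \<in> alphabet C" using assms by (auto simp: complete_def)
  then show ?thesis
    unfolding Some by (metis complete_transition_simps(1,2))
qed

context buchi_automaton
begin

section \<open>Dependence on finite prefixes of the word\<close>

lemma tseq_cong: "(\<And>i. i < k \<Longrightarrow> w i = w' i) \<Longrightarrow> tseq w N T k = tseq w' N T k"
  by (induction k) auto

lemma reach_cong: "(\<And>i. i < k \<Longrightarrow> w i = w' i) \<Longrightarrow> reach w k = reach w' k"
  using tseq_cong unfolding reach_def by metis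

lemma tseq_target_irrelevant: "k < N \<Longrightarrow> tseq w N T k = tseq w N T' k"
  by (simp add: tseq_before)

text \<open>The state at time \<open>k\<close> is built from letters and virtual spoiler states at
  times before \<open>k\<close>, so the target first matters at \<open>Suc N\<close>. An online
  strategy can thus choose it after reading \<open>N\<close> letters.\<close>

lemma pseq_cong:
  assumes "\<And>i. i < k \<Longrightarrow> w i = w' i" and "N < k \<Longrightarrow> T = T'"
  shows "pseq w N T k = pseq w' N T' k"
  using assms
proof (induction k)
  case (Suc k)
  have "tseq w N T k = tseq w' N T k" using Suc.prems(1) by (intro tseq_cong) simp
  also have "\<dots> = tseq w' N T' k"
    using Suc.prems(2) tseq_target_irrelevant[of k N] by (cases "k < N") auto
  finally show ?case using Suc by simp
qed simp

lemma witness_Suc: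
  assumes "witness w n T"
  shows "witness w (Suc n) (fst (tseq w n T (Suc n)))"
  unfolding witness_def
proof (intro conjI allI impI)
  have T: "T \<subseteq> reach w n" using assms by (simp add: witness_def)
  show "fst (tseq w n T (Suc n)) \<subseteq> reach w (Suc n)"
    by (rule witness_subset_reach[OF T]) simp
  fix m assume m: "m \<ge> Suc n"
  then show "jump_accepts w m (fst (tseq w (Suc n) (fst (tseq w n T (Suc n))) m))"
    using assms fst_tseq_shift[of n "Suc n" m w T] by (simp add: witness_def)
qed

lemma sets_witness:
  fixes M :: "('s::countable, 'act::countable, 'a) mdp"
  shows "{\<omega>. witness (labeled_run M \<omega>) n T} \<in> sets paths"
proof -
  let ?w = "labeled_run M"
  have *: "{\<omega>. jump_accepts (?w \<omega>) m (fst (tseq (?w \<omega>) n T m))} \<in> sets paths" for m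
  proof -
    \<comment> \<open>The target uses the letters before \<open>m\<close> and the breakpoint those
      up to \<open>k\<close>, hence prefixes of length \<open>max m (Suc k)\<close> below.\<close>
    define P where "P k h \<longleftrightarrow>
      brk (tseq (?w ((!) h)) m (fst (tseq (?w ((!) h)) n T m)) k) (?w ((!) h) k)" for k h
    have "P k (segment \<omega> (max m (Suc k))) \<longleftrightarrow>
        brk (tseq (?w \<omega>) m (fst (tseq (?w \<omega>) n T m)) k) (?w \<omega> k)" for k \<omega>
    proof -
      let ?h = "segment \<omega> (max m (Suc k))"
      have w: "?w ((!) ?h) i = ?w \<omega> i" if "i < max m (Suc k)" for i
        using that by (rule labeled_run_segment)
      have 1: "tseq (?w ((!) ?h)) n T m = tseq (?w \<omega>) n T m"
        by (rule tseq_cong, rule w) simp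
      have 2: "tseq (?w ((!) ?h)) m X k = tseq (?w \<omega>) m X k" for X
        by (rule tseq_cong, rule w) simp
      have 3: "?w ((!) ?h) k = ?w \<omega> k" by (rule w) simp
      show ?thesis unfolding P_def 1 2 3 ..
    qed
    then have "{\<omega>. jump_accepts (?w \<omega>) m (fst (tseq (?w \<omega>) n T m))} =
        {\<omega>. \<exists>\<^sub>\<infinity>k. P k (segment \<omega> (max m (Suc k)))}"
      by (simp only: jump_accepts_def)
    then show ?thesis
      using sets_Collect_infinite_segment[of P "\<lambda>k. max m (Suc k)"] by simp
  qed
  have "reach (?w ((!) (segment \<omega> n))) n = reach (?w \<omega>) n" for \<omega>
    by (rule reach_cong, rule labeled_run_segment)
  then have "{\<omega>. T \<subseteq> reach (?w \<omega>) n} = {\<omega>. T \<subseteq> reach (?w ((!) (segment \<omega> n))) n}"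
    by simp
  also have "\<dots> \<in> sets paths"
    by (rule sets_Collect_segment[where P = "\<lambda>h. T \<subseteq> reach (?w ((!) h)) n"])
  finally have "{\<omega>. T \<subseteq> reach (?w \<omega>) n} \<in> sets paths" .
  moreover have "{\<omega>. witness (?w \<omega>) n T} = {\<omega>. T \<subseteq> reach (?w \<omega>) n} \<inter>
      (\<Inter>m. if n \<le> m then {\<omega>. jump_accepts (?w \<omega>) m (fst (tseq (?w \<omega>) n T m))} else UNIV)"
    by (auto simp: witness_def split: if_splits)
  moreover have "(\<Inter>m. if n \<le> m then {\<omega>. jump_accepts (?w \<omega>) m (fst (tseq (?w \<omega>) n T m))} else UNIV)
      \<in> sets paths"
    using * sets.top[of "paths :: (nat \<Rightarrow> 'act \<times> 's) measure"]
    by (intro sets.countable_INT'') simp_all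
  ultimately show ?thesis by auto
qed

lemma sets_language_slim:
  fixes M :: "('s::countable, 'act::countable, 'a) mdp"
  shows "{\<omega>. labeled_run M \<omega> \<in> language (slim_aut B)} \<in> sets paths"
proof -
  have "{\<omega>. labeled_run M \<omega> n \<in> alphabet B} \<in> sets paths" for n
    using sets_Collect_segment[of "\<lambda>h. labeled_run M ((!) h) n \<in> alphabet B" "Suc n"]
    by (simp only: labeled_run_segment[OF lessI])
  moreover have "(\<Union>T. {\<omega>. witness (labeled_run M \<omega>) n T}) \<in> sets paths" for n
    using sets_witness by (intro sets.countable_UN' countableI_type) auto
  ultimately have "(\<Inter>n. {\<omega>. labeled_run M \<omega> n \<in> alphabet B}) \<inter>
      (\<Union>n. \<Union>T. {\<omega>. witness (labeled_run M \<omega>) n T}) \<in> sets paths"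
    using sets.top[of "paths :: (nat \<Rightarrow> 'act \<times> 's) measure"]
    by (intro sets.Int sets.countable_INT'' sets.countable_UN' countableI_type) auto
  moreover have "{\<omega>. labeled_run M \<omega> \<in> language (slim_aut B)} =
      (\<Inter>n. {\<omega>. labeled_run M \<omega> n \<in> alphabet B}) \<inter>
      (\<Union>n. \<Union>T. {\<omega>. witness (labeled_run M \<omega>) n T})"
    by (auto simp: language_slim_iff)
  ultimately show ?thesis by simp
qed

text \<open>Before time \<open>N\<close> the guess \<open>G (take N h)\<close> is made from too
  short a history; this is harmless because \<open>pseq\<close> does not look at its target
  yet.\<close>

definition online :: "('s, 'act, 'a) mdp \<Rightarrow> nat \<Rightarrow> (('act \<times> 's) list \<Rightarrow> 'q set) \<Rightarrow>
    ('act \<times> 's) list \<Rightarrow> ('q set \<times> 'q set) option" where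
  "online M N G h = live (pseq (labeled_run M ((!) h)) N (G (take N h)) (length h))"

lemma online_segment:
  "online M N G (segment \<omega> n) = live (pseq (labeled_run M \<omega>) N (G (segment \<omega> N)) n)"
proof -
  have "pseq (labeled_run M ((!) (segment \<omega> n))) N (G (take N (segment \<omega> n))) n =
      pseq (labeled_run M \<omega>) N (G (segment \<omega> N)) n"
    by (rule pseq_cong) (simp_all only: labeled_run_segment take_segment less_imp_le)
  then show ?thesis by (simp add: online_def)
qed

lemma online_transition:
  assumes M: "mdp_over (alphabet B) M" and h: "finite_run M (h @ [(a, s')])"
  shows "(online M N G h, label M (last_state (mdp_init M) h) a s', online M N G (h @ [(a, s')]))
    \<in> transitions (complete (slim_aut B))"
proof -
  define \<omega> where "\<omega> = (!) (h @ [(a, s')])"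
  let ?n = "length h"
  have "h @ [(a, s')] = segment \<omega> (Suc ?n)"
    using map_nth[of "h @ [(a, s')]"] by (simp only: \<omega>_def length_append_singleton)
  moreover from this have "h = segment \<omega> ?n" by (simp only: segment_Suc append1_eq_conv)
  moreover have lab: "labeled_run M \<omega> ?n = label M (last_state (mdp_init M) h) a s'"
    by (simp add: labeled_run_def \<omega>_def state_at_append last_state_def)
  moreover have "label M (last_state (mdp_init M) h) a s' \<in> alphabet B"
    using label_in_alphabet[OF M] h by (simp add: finite_run_snoc)
  ultimately show ?thesis
    using pseq_transition[of "labeled_run M \<omega>" ?n N "G (segment \<omega> N)"] by (metis online_segment)
qed

lemma AE_labels:
  assumes M: "mdp_over (alphabet B) M" and f: "f \<in> strategies M"
  shows "AE \<omega> in path_measure (step_pmf M f). \<forall>n. labeled_run M \<omega> n \<in> alphabet B"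
  using AE_finite_run[OF f]
proof (rule AE_mp, intro AE_I2 impI allI)
  fix \<omega> n assume "\<forall>n. finite_run M (segment \<omega> n)"
  then have "finite_run M (segment \<omega> n @ [(fst (\<omega> n), snd (\<omega> n))])"
    by (metis segment_Suc prod.collapse)
  then show "labeled_run M \<omega> n \<in> alphabet B"
    using label_in_alphabet[OF M, of "segment \<omega> n" "fst (\<omega> n)" "snd (\<omega> n)"]
    unfolding finite_run_snoc by (simp add: labeled_run_def last_state_segment)
qed

text \<open>
  At a late time \<^term>\<open>N\<close> some target is, up to a small probability, already correct, and the
  events that the individual targets are correct are almost determined by the history.
\<close>

lemma online_near_optimal:
  fixes M :: "('s::countable, 'act::countable, 'a) mdp"
  assumes M: "mdp_over (alphabet B) M" and f: "f \<in> strategies M" and e: "0 < e"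
  shows "\<exists>N G. emeasure (path_measure (step_pmf M f)) {\<omega>. labeled_run M \<omega> \<in> language (slim_aut B)} \<le>
    emeasure (path_measure (step_pmf M f)) {\<omega>. accepting (complete (slim_aut B)) (labeled_run M \<omega>)
      (\<lambda>n. online M N G (segment \<omega> n))} + ennreal e"
proof -
  define \<mu> where "\<mu> = path_measure (step_pmf M f)"
  interpret prob_space \<mu> unfolding \<mu>_def by (rule prob_space_path_measure)
  have sets_\<mu>: "sets \<mu> = sets paths" by (simp add: \<mu>_def sets_path_measure)
  let ?w = "labeled_run M"
  define W where "W n T = {\<omega>. witness (?w \<omega>) n T}" for n T
  have W: "W n T \<in> events" for n T by (simp add: W_def sets_\<mu> sets_witness)
  define U where "U n = (\<Union>T. W n T)" for n
  have U: "U n \<in> events" for n unfolding U_def using W by (intro sets.countable_UN' countableI_type) auto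
  have "incseq U"
    by (rule incseq_SucI) (auto simp: U_def W_def intro: witness_Suc)
  then have "(\<lambda>n. prob (U n)) \<longlonglongrightarrow> prob (\<Union>n. U n)"
    using U by (intro finite_Lim_measure_incseq) auto
  then have "\<forall>\<^sub>F n in sequentially. prob (U n) > prob (\<Union>n. U n) - e / 2"
    using e by (intro order_tendstoD(1)) auto
  then obtain N0 where N0: "prob (U N0) > prob (\<Union>n. U n) - e / 2"
    by (auto simp: eventually_sequentially)
  \<comment> \<open>One half of \<open>e\<close> pays for witnesses that appear only after
    \<open>N0\<close>, the other half, shared among all targets, for wrong guesses.\<close>
  define d where "d = e / (2 * real (card (UNIV :: 'q set set)))"
  have d: "d > 0" using e by (simp add: d_def card_gt_0_iff)
  have "\<exists>n C. prob (sym_diff (W N0 T) {\<omega>. segment \<omega> n \<in> C}) < d" for T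
    unfolding \<mu>_def by (rule approx_by_segment[OF _ d]) (use W[of N0 T] in \<open>simp add: sets_\<mu>\<close>)
  then have "\<exists>n. \<forall>T. \<exists>C. prob (sym_diff (W N0 T) {\<omega>. segment \<omega> (n T) \<in> C}) < d"
    by (intro choice allI)
  then obtain n where "\<forall>T. \<exists>C. prob (sym_diff (W N0 T) {\<omega>. segment \<omega> (n T) \<in> C}) < d" ..
  then obtain C where nC: "\<And>T. prob (sym_diff (W N0 T) {\<omega>. segment \<omega> (n T) \<in> C T}) < d"
    using choice[of "\<lambda>T C. prob (sym_diff (W N0 T) {\<omega>. segment \<omega> (n T) \<in> C}) < d"] by blast
  \<comment> \<open>Outside \<open>bad\<close> the tests are right for all targets at once, so
    \<open>SOME\<close> may pick any target whose test succeeds.\<close>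
  define bad where "bad = (\<Union>T. sym_diff (W N0 T) {\<omega>. segment \<omega> (n T) \<in> C T})"
  have cl: "{\<omega>. segment \<omega> (n T) \<in> C T} \<in> events" for T
    using sets_Collect_segment[of "\<lambda>h. h \<in> C T" "n T"] by (simp add: sets_\<mu>)
  have sd: "sym_diff (W N0 T) {\<omega>. segment \<omega> (n T) \<in> C T} \<in> events" for T
    using W cl by auto
  have bad: "bad \<in> events" unfolding bad_def using sd by (intro sets.countable_UN' countableI_type) auto
  have "prob bad \<le> (\<Sum>T\<in>UNIV. prob (sym_diff (W N0 T) {\<omega>. segment \<omega> (n T) \<in> C T}))"
    unfolding bad_def using sd by (intro finite_measure_subadditive_finite) auto
  also have "\<dots> \<le> (\<Sum>T\<in>(UNIV :: 'q set set). d)"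
    by (intro sum_mono less_imp_le nC)
  also have "\<dots> = e / 2" by (simp add: d_def)
  finally have prob_bad: "prob bad \<le> e / 2" .
  \<comment> \<open>By time \<open>N\<close> all tests can be evaluated. The target found for
    \<open>N0\<close> is then advanced to \<open>N\<close>, and \<open>witness\<close> guarantees
    success of the jump from there.\<close>
  define N where "N = max N0 (Max (range n))"
  have N: "N0 \<le> N" "n T \<le> N" for T by (simp_all add: N_def max.coboundedI2)
  define G where "G h = fst (tseq (?w ((!) h)) N0 (SOME T. take (n T) h \<in> C T) N)" for h
  let ?A = "{\<omega>. accepting (complete (slim_aut B)) (?w \<omega>) (\<lambda>k. online M N G (segment \<omega> k))}"
  have success: "\<omega> \<in> ?A" if \<omega>: "\<omega> \<in> U N0 - bad" and lab: "\<forall>k. ?w \<omega> k \<in> alphabet B" for \<omega>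
  proof -
    have agree: "\<omega> \<in> W N0 T \<longleftrightarrow> segment \<omega> (n T) \<in> C T" for T
      using \<omega> by (auto simp: bad_def)
    define T where "T = (SOME T. segment \<omega> (n T) \<in> C T)"
    have "\<exists>T. segment \<omega> (n T) \<in> C T" using \<omega> agree by (auto simp: U_def)
    then have "segment \<omega> (n T) \<in> C T" unfolding T_def by (rule someI_ex)
    then have wit: "witness (?w \<omega>) N0 T" using agree by (simp add: W_def)
    have "take (n T) (segment \<omega> N) = segment \<omega> (n T)" for T by (rule take_segment[OF N(2)])
    then have "G (segment \<omega> N) = fst (tseq (?w ((!) (segment \<omega> N))) N0 T N)"
      unfolding G_def T_def by simp
    also have "\<dots> = fst (tseq (?w \<omega>) N0 T N)"
      using tseq_cong[of N "?w ((!) (segment \<omega> N))" "?w \<omega>"] labeled_run_segment[of _ N M \<omega>] by simp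
    finally have G: "G (segment \<omega> N) = fst (tseq (?w \<omega>) N0 T N)" .
    have "jump_accepts (?w \<omega>) N (G (segment \<omega> N))" "G (segment \<omega> N) \<subseteq> reach (?w \<omega>) N"
      unfolding G using wit N(1) witness_subset_reach by (auto simp: witness_def)
    then show ?thesis
      using pseq_accepting lab by (simp add: online_segment)
  qed
  have A: "?A \<in> events"
  proof -
    have "?A = {\<omega>. \<exists>\<^sub>\<infinity>k. (online M N G (take k (segment \<omega> (Suc k))),
        ?w ((!) (segment \<omega> (Suc k))) k, online M N G (segment \<omega> (Suc k)))
        \<in> acc_transitions (complete (slim_aut B))}"
      unfolding accepting_def
      by (simp only: take_segment[OF le_SucI[OF order_refl]] labeled_run_segment[OF lessI])
    also have "\<dots> \<in> sets paths"
      by (rule sets_Collect_infinite_segment[where f = Suc and P = "\<lambda>k h. (online M N G (take k h),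
            ?w ((!) h) k, online M N G h) \<in> acc_transitions (complete (slim_aut B))"])
    finally show ?thesis by (simp add: sets_\<mu>)
  qed
  have "prob {\<omega>. ?w \<omega> \<in> language (slim_aut B)} \<le> prob (\<Union>n. U n)"
    using U by (intro finite_measure_mono) (auto simp: language_slim_iff U_def W_def)
  also have "\<dots> \<le> prob (U N0) + e / 2" using N0 by simp
  also have "prob (U N0) \<le> prob ((U N0 - bad) \<union> bad)"
    using U bad by (intro finite_measure_mono) auto
  also have "\<dots> \<le> prob (U N0 - bad) + prob bad"
    using U bad by (intro measure_Un_le) auto
  also have "prob (U N0 - bad) \<le> prob ?A"
    using A success AE_labels[OF M f, folded \<mu>_def]
    by (intro finite_measure_mono_AE) (auto elim!: eventually_mono)
  finally have "prob {\<omega>. ?w \<omega> \<in> language (slim_aut B)} \<le> prob ?A + e"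
    using prob_bad by simp
  then have "emeasure \<mu> {\<omega>. ?w \<omega> \<in> language (slim_aut B)} \<le> emeasure \<mu> ?A + ennreal e"
    using e by (simp add: emeasure_eq_measure flip: ennreal_plus)
  then show ?thesis unfolding \<mu>_def by blast
qed

lemma good_for_mdps_slim:
  "good_for_mdps TYPE('s::countable) TYPE('act::countable) (slim_aut B)"
  unfolding good_for_mdps_def slim_aut_simps
proof (intro allI impI antisym)
  fix M :: "('s, 'act, 'a) mdp" assume M: "mdp_over (alphabet B) M"
  show "PSyn M (complete (slim_aut B)) \<le> PSem M (slim_aut B)"
    by (rule PSyn_complete_le_PSem[OF buchi_slim_aut[OF buchi]])
      (use M sets_language_slim in simp_all)
  show "PSem M (slim_aut B) \<le> PSyn M (complete (slim_aut B))"
    unfolding PSem_def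
  proof (rule SUP_least, rule ennreal_le_epsilon)
    fix f and e :: real assume f: "f \<in> strategies M" and e: "0 < e"
    let ?D = "complete (slim_aut B)"
    obtain N G where NG: "emeasure (path_measure (step_pmf M f))
        {\<omega>. labeled_run M \<omega> \<in> language (slim_aut B)} \<le>
      emeasure (path_measure (step_pmf M f))
        {\<omega>. accepting ?D (labeled_run M \<omega>) (\<lambda>n. online M N G (segment \<omega> n))} + ennreal e"
      using online_near_optimal[OF M f e] by blast
    have D: "initial ?D = {Some (initial B, {})}" "alphabet ?D = alphabet B"
      by (simp_all add: complete_def)
    have "emeasure (path_measure (step_pmf M f))
        {\<omega>. accepting ?D (labeled_run M \<omega>) (\<lambda>n. online M N G (segment \<omega> n))} \<le> PSyn M ?D"
      using M online_transition[OF M]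
      by (intro PSyn_ge_online[OF buchi_complete[OF buchi_slim_aut[OF buchi]] D(1) complete_total _ f])
        (simp_all add: D(2) online_def live_initial)
    then show "emeasure (path_measure (step_pmf M f)) {\<omega>. labeled_run M \<omega> \<in> language (slim_aut B)}
        \<le> PSyn M ?D + ennreal e"
      using NG by (meson add_right_mono order_trans)
  qed
qed

end

theorem theorem2:
  fixes B :: "('a, 'q::finite) nba"
  assumes "buchi B"
  shows "simulates (slim_aut B) (limit_det B) \<and>
         slim (slim_aut B) \<and>
         language (slim_aut B) = language B \<and>
         good_for_mdps TYPE('s::countable) TYPE('act::countable) (slim_aut B)"
proof -
  interpret buchi_automaton B using assms by unfold_locales
  show ?thesis
    using simulates_slim_limit_det slim_slim_aut language_slim good_for_mdps_slim by blast
qed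

end
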